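(* Let $\lambda\in[0,1]$. The balanced 2-median problem on a tree $T=(V,E)$ with $n\ge 2$ vertices $v_1,\dots,v_n$, nonnegative edge lengths, nonnegative vertex weights $w_i$ and nonnegative service times $t_i$ can be solved in $O(n^2)$ time by the following edge deletion method: for every edge $e$ of $T$, let $T_1^e,T_2^e$ be the two subtrees obtained by deleting $e$, let $m_1^e$ and $m_2^e$ be 1-medians of $T_1^e$ and $T_2^e$ respectively, and compute $$f_{pmed}(m_1^e,m_2^e)=\lambda\Big(\sum_{v_i\in T_1^e}w_i\,d(v_i,m_1^e)+\sum_{v_i\in T_2^e}w_i\,d(v_i,m_2^e)\Big)+(1-\lambda)\Big|\sum_{v_i\in T_1^e}z_i-\sum_{v_i\in T_2^e}z_i\Big|;$$ then an edge $e$ for which this value is minimum, together with the pair $(m_1^e,m_2^e)$, is an optimal solution of the balanced 2-median problem.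
   Context: Running time counts elementary operations (arithmetic operations and comparisons of real numbers at unit cost). $d(\cdot,\cdot)$ denotes the shortest-path distance in $T$ with respect to the edge lengths. Put $z_i=w_it_i$. A 1-median of a subtree $T'$ is a vertex $m$ of $T'$ minimizing $\sum_{v_i\in T'}w_i\,d(v_i,m)$ over all vertices of $T'$. Balanced 2-median problem on $T$ with parameter $\lambda$: a feasible solution consists of an edge of $T$, whose deletion splits $T$ into two subtrees $T_1$ and $T_2$, together with two facilities (vertices) $x_1\in T_1$ and $x_2\in T_2$; all vertices of $T_1$ are allocated to $x_1$ and all vertices of $T_2$ are allocated to $x_2$. The objective, to be minimized over all feasible solutions, is $$f_{pmed}=\lambda\Big(\sum_{v_i\in T_1}w_i\,d(v_i,x_1)+\sum_{v_i\in T_2}w_i\,d(v_i,x_2)\Big)+(1-\lambda)\Big|\sum_{v_i\in T_1}z_i-\sum_{v_i\in T_2}z_i\Big|.$$ *)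

theory Defs
  imports Complex_Main "HOL-Library.Landau_Symbols"
begin

section \<open>Undirected trees\<close>

text \<open>
  Edges are two-element sets of vertices. In the library for directed graphs the notion of a tree
  cannot be used for symmetric digraphs, since there \<open>a, b, a\<close> counts as a cycle.
\<close>

definition is_path :: "'a set \<Rightarrow> 'a set set \<Rightarrow> 'a \<Rightarrow> 'a list \<Rightarrow> 'a \<Rightarrow> bool" where
  "is_path V E u xs v \<longleftrightarrow>
     xs \<noteq> [] \<and> hd xs = u \<and> last xs = v \<and> distinct xs \<and> set xs \<subseteq> V \<and>
     successively (\<lambda>x y. {x, y} \<in> E) xs"

definition is_cycle :: "'a set \<Rightarrow> 'a set set \<Rightarrow> 'a list \<Rightarrow> bool" where
  "is_cycle V E xs \<longleftrightarrow>
     3 \<le> length xs \<and> is_path V E (hd xs) xs (last xs) \<and> {last xs, hd xs} \<in> E"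

definition is_tree :: "'a set \<Rightarrow> 'a set set \<Rightarrow> bool" where
  "is_tree V E \<longleftrightarrow>
     finite V \<and> V \<noteq> {} \<and> (\<forall>e\<in>E. e \<subseteq> V \<and> card e = 2) \<and>
     (\<forall>u\<in>V. \<forall>v\<in>V. \<exists>xs. is_path V E u xs v) \<and>
     (\<nexists>xs. is_cycle V E xs)"

definition components :: "'a set \<Rightarrow> 'a set set \<Rightarrow> 'a set set" where
  "components V E = (\<lambda>v. {u. \<exists>xs. is_path V E v xs u}) ` V"

definition path_length :: "('a set \<Rightarrow> real) \<Rightarrow> 'a list \<Rightarrow> real" where
  "path_length len xs = sum_list (map2 (\<lambda>x y. len {x, y}) xs (tl xs))"

definition sp_dist :: "'a set \<Rightarrow> 'a set set \<Rightarrow> ('a set \<Rightarrow> real) \<Rightarrow> 'a \<Rightarrow> 'a \<Rightarrow> real" where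
  "sp_dist V E len u v = (INF xs\<in>{xs. is_path V E u xs v}. path_length len xs)"


section \<open>The balanced 2-median problem\<close>

record median_instance =
  num_verts :: nat
  edges :: "nat set set"
  edge_len :: "nat set \<Rightarrow> real"
  weight :: "nat \<Rightarrow> real"
  service :: "nat \<Rightarrow> real"
  lam :: real

definition verts :: "median_instance \<Rightarrow> nat set" where
  "verts I = {1..num_verts I}"

definition valid_instance :: "median_instance \<Rightarrow> bool" where
  "valid_instance I \<longleftrightarrow>
     2 \<le> num_verts I \<and> is_tree (verts I) (edges I) \<and>
     (\<forall>e\<in>edges I. 0 \<le> edge_len I e) \<and>
     (\<forall>i\<in>verts I. 0 \<le> weight I i \<and> 0 \<le> service I i) \<and>
     0 \<le> lam I \<and> lam I \<le> 1"

definition dst :: "median_instance \<Rightarrow> nat \<Rightarrow> nat \<Rightarrow> real" where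
  "dst I = sp_dist (verts I) (edges I) (edge_len I)"

definition z :: "median_instance \<Rightarrow> nat \<Rightarrow> real" where
  "z I i = weight I i * service I i"

text \<open>Subtrees are represented by their vertex sets.\<close>

definition median_cost :: "median_instance \<Rightarrow> nat set \<Rightarrow> nat \<Rightarrow> real" where
  "median_cost I T x = (\<Sum>i\<in>T. weight I i * dst I i x)"

definition one_median :: "median_instance \<Rightarrow> nat set \<Rightarrow> nat \<Rightarrow> bool" where
  "one_median I T m \<longleftrightarrow> m \<in> T \<and> (\<forall>x\<in>T. median_cost I T m \<le> median_cost I T x)"

definition splits :: "median_instance \<Rightarrow> nat set \<Rightarrow> nat set \<Rightarrow> nat set \<Rightarrow> bool" where
  "splits I e T1 T2 \<longleftrightarrow>
     e \<in> edges I \<and> T1 \<noteq> T2 \<and> components (verts I) (edges I - {e}) = {T1, T2}"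

definition f_pmed :: "median_instance \<Rightarrow> nat set \<Rightarrow> nat set \<Rightarrow> nat \<Rightarrow> nat \<Rightarrow> real" where
  "f_pmed I T1 T2 x1 x2 =
     lam I * ((\<Sum>i\<in>T1. weight I i * dst I i x1) + (\<Sum>i\<in>T2. weight I i * dst I i x2)) +
     (1 - lam I) * \<bar>(\<Sum>i\<in>T1. z I i) - (\<Sum>i\<in>T2. z I i)\<bar>"

definition feasible ::
    "median_instance \<Rightarrow> nat set \<Rightarrow> nat set \<Rightarrow> nat set \<Rightarrow> nat \<Rightarrow> nat \<Rightarrow> bool" where
  "feasible I e T1 T2 x1 x2 \<longleftrightarrow> splits I e T1 T2 \<and> x1 \<in> T1 \<and> x2 \<in> T2"

definition optimal ::
    "median_instance \<Rightarrow> nat set \<Rightarrow> nat set \<Rightarrow> nat set \<Rightarrow> nat \<Rightarrow> nat \<Rightarrow> bool" where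
  "optimal I e T1 T2 x1 x2 \<longleftrightarrow>
     feasible I e T1 T2 x1 x2 \<and>
     (\<forall>e' T1' T2' x1' x2'. feasible I e' T1' T2' x1' x2' \<longrightarrow>
        f_pmed I T1 T2 x1 x2 \<le> f_pmed I T1' T2' x1' x2')"

text \<open>
  A run of the edge deletion method: for every edge an (arbitrary) naming of the two subtrees, an
  (arbitrary) choice of 1-medians of both, and an edge \<open>e\<close> at which the resulting value is minimum.
\<close>

definition edge_deletion_run ::
    "median_instance \<Rightarrow> (nat set \<Rightarrow> nat set) \<Rightarrow> (nat set \<Rightarrow> nat set) \<Rightarrow>
     (nat set \<Rightarrow> nat) \<Rightarrow> (nat set \<Rightarrow> nat) \<Rightarrow> nat set \<Rightarrow> bool" where
  "edge_deletion_run I T1 T2 m1 m2 e \<longleftrightarrow>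
     (\<forall>e'\<in>edges I. splits I e' (T1 e') (T2 e') \<and>
        one_median I (T1 e') (m1 e') \<and> one_median I (T2 e') (m2 e')) \<and>
     e \<in> edges I \<and>
     (\<forall>e'\<in>edges I. f_pmed I (T1 e) (T2 e) (m1 e) (m2 e)
                   \<le> f_pmed I (T1 e') (T2 e') (m1 e') (m2 e'))"


section \<open>A real random access machine with unit costs\<close>

text \<open>
  Programs are while programs over two separate memories: natural numbers, used as indices and
  counters with addition and truncated subtraction only, and real numbers with the four arithmetic
  operations and comparison. There is no conversion between the two memories, in particular no
  rounding. Every operation, memory access and test costs at least one unit.
\<close>

record state =
  ivar :: "string \<Rightarrow> nat"
  iarr :: "string \<Rightarrow> nat \<Rightarrow> nat"
  rvar :: "string \<Rightarrow> real"
  rarr :: "string \<Rightarrow> nat \<Rightarrow> real"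

datatype iexp =
    IConst nat | IVar string | IArr string iexp | IAdd iexp iexp | ISub iexp iexp

datatype rexp =
    RConst int | RVar string | RArr string iexp
  | RAdd rexp rexp | RSub rexp rexp | RMul rexp rexp | RDiv rexp rexp

datatype bexp = ILess iexp iexp | RLess rexp rexp | BNot bexp | BAnd bexp bexp

datatype com =
    Skip
  | ISet string iexp
  | IStore string iexp iexp
  | RSet string rexp
  | RStore string iexp rexp
  | Seq com com
  | Cond bexp com com
  | While bexp com

primrec ival :: "iexp \<Rightarrow> state \<Rightarrow> nat" where
  "ival (IConst k) s = k"
| "ival (IVar x) s = ivar s x"
| "ival (IArr a i) s = iarr s a (ival i s)"
| "ival (IAdd a b) s = ival a s + ival b s"
| "ival (ISub a b) s = ival a s - ival b s"

primrec rval :: "rexp \<Rightarrow> state \<Rightarrow> real" where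
  "rval (RConst k) s = of_int k"
| "rval (RVar x) s = rvar s x"
| "rval (RArr a i) s = rarr s a (ival i s)"
| "rval (RAdd a b) s = rval a s + rval b s"
| "rval (RSub a b) s = rval a s - rval b s"
| "rval (RMul a b) s = rval a s * rval b s"
| "rval (RDiv a b) s = rval a s / rval b s"

primrec bval :: "bexp \<Rightarrow> state \<Rightarrow> bool" where
  "bval (ILess a b) s \<longleftrightarrow> ival a s < ival b s"
| "bval (RLess a b) s \<longleftrightarrow> rval a s < rval b s"
| "bval (BNot b) s \<longleftrightarrow> \<not> bval b s"
| "bval (BAnd a b) s \<longleftrightarrow> bval a s \<and> bval b s"

primrec icost :: "iexp \<Rightarrow> nat" where
  "icost (IConst k) = 1"
| "icost (IVar x) = 1"
| "icost (IArr a i) = icost i + 1"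
| "icost (IAdd a b) = icost a + icost b + 1"
| "icost (ISub a b) = icost a + icost b + 1"

primrec rcost :: "rexp \<Rightarrow> nat" where
  "rcost (RConst k) = 1"
| "rcost (RVar x) = 1"
| "rcost (RArr a i) = icost i + 1"
| "rcost (RAdd a b) = rcost a + rcost b + 1"
| "rcost (RSub a b) = rcost a + rcost b + 1"
| "rcost (RMul a b) = rcost a + rcost b + 1"
| "rcost (RDiv a b) = rcost a + rcost b + 1"

primrec bcost :: "bexp \<Rightarrow> nat" where
  "bcost (ILess a b) = icost a + icost b + 1"
| "bcost (RLess a b) = rcost a + rcost b + 1"
| "bcost (BNot b) = bcost b + 1"
| "bcost (BAnd a b) = bcost a + bcost b + 1"

text \<open>\<open>exec c s k s'\<close>: started in \<open>s\<close>, \<open>c\<close> terminates in \<open>s'\<close> at total cost \<open>k\<close>.\<close>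

inductive exec :: "com \<Rightarrow> state \<Rightarrow> nat \<Rightarrow> state \<Rightarrow> bool" where
  Skip: "exec Skip s 1 s"
| ISet: "exec (ISet x a) s (icost a + 1) (s\<lparr>ivar := (ivar s)(x := ival a s)\<rparr>)"
| IStore: "exec (IStore x i a) s (icost i + icost a + 1)
     (s\<lparr>iarr := (iarr s)(x := (iarr s x)(ival i s := ival a s))\<rparr>)"
| RSet: "exec (RSet x a) s (rcost a + 1) (s\<lparr>rvar := (rvar s)(x := rval a s)\<rparr>)"
| RStore: "exec (RStore x i a) s (icost i + rcost a + 1)
     (s\<lparr>rarr := (rarr s)(x := (rarr s x)(ival i s := rval a s))\<rparr>)"
| Seq: "exec c1 s1 k1 s2 \<Longrightarrow> exec c2 s2 k2 s3 \<Longrightarrow> exec (Seq c1 c2) s1 (k1 + k2) s3"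
| CondTrue: "bval b s \<Longrightarrow> exec c1 s k s' \<Longrightarrow> exec (Cond b c1 c2) s (bcost b + 1 + k) s'"
| CondFalse: "\<not> bval b s \<Longrightarrow> exec c2 s k s' \<Longrightarrow> exec (Cond b c1 c2) s (bcost b + 1 + k) s'"
| WhileFalse: "\<not> bval b s \<Longrightarrow> exec (While b c) s (bcost b + 1) s"
| WhileTrue: "bval b s1 \<Longrightarrow> exec c s1 k1 s2 \<Longrightarrow> exec (While b c) s2 k2 s3 \<Longrightarrow>
     exec (While b c) s1 (bcost b + 1 + k1 + k2) s3"

lemma exec_deterministic:
  "exec c s k s' \<Longrightarrow> exec c s k2 s2 \<Longrightarrow> k2 = k \<and> s2 = s'"
proof (induction arbitrary: k2 s2 rule: exec.induct)
  case Seq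
  from Seq.prems show ?case by cases (auto dest!: Seq.IH)
next
  case CondTrue
  from CondTrue.prems show ?case by cases (use CondTrue.hyps in \<open>auto dest!: CondTrue.IH\<close>)
next
  case CondFalse
  from CondFalse.prems show ?case by cases (use CondFalse.hyps in \<open>auto dest!: CondFalse.IH\<close>)
next
  case WhileFalse
  from WhileFalse.prems show ?case by cases (use WhileFalse.hyps in auto)
next
  case WhileTrue
  from WhileTrue.prems show ?case by cases (use WhileTrue.hyps in \<open>auto dest!: WhileTrue.IH\<close>)
qed (erule exec.cases; simp)+


section \<open>Input and output of programs\<close>

text \<open>
  The edges are given as a list of unordered pairs in any order; \<open>input_edge s k\<close> is the \<open>k\<close>-th one.
  Memory cells not mentioned in \<open>encodes\<close> have arbitrary contents.
\<close>

definition input_edge :: "state \<Rightarrow> nat \<Rightarrow> nat set" where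
  "input_edge s k = {iarr s ''u'' k, iarr s ''v'' k}"

definition encodes :: "state \<Rightarrow> median_instance \<Rightarrow> bool" where
  "encodes s I \<longleftrightarrow>
     ivar s ''n'' = num_verts I \<and> ivar s ''m'' = card (edges I) \<and>
     bij_betw (input_edge s) {1..card (edges I)} (edges I) \<and>
     (\<forall>k\<in>{1..card (edges I)}. rarr s ''len'' k = edge_len I (input_edge s k)) \<and>
     (\<forall>i\<in>verts I. rarr s ''w'' i = weight I i \<and> rarr s ''t'' i = service I i) \<and>
     rvar s ''lambda'' = lam I"

text \<open>
  The final state \<open>s'\<close> holds, for every edge, the two 1-medians and the value of the method,
  and the selected edge (by its index in the input) with its pair of facilities.
\<close>

definition outputs ::
    "state \<Rightarrow> state \<Rightarrow> median_instance \<Rightarrow> (nat set \<Rightarrow> nat set) \<Rightarrow> (nat set \<Rightarrow> nat set) \<Rightarrow>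
     (nat set \<Rightarrow> nat) \<Rightarrow> (nat set \<Rightarrow> nat) \<Rightarrow> nat set \<Rightarrow> bool" where
  "outputs s s' I T1 T2 m1 m2 e \<longleftrightarrow>
     (\<forall>k\<in>{1..card (edges I)}. let e' = input_edge s k in
        iarr s' ''m1'' k = m1 e' \<and> iarr s' ''m2'' k = m2 e' \<and>
        rarr s' ''f'' k = f_pmed I (T1 e') (T2 e') (m1 e') (m2 e')) \<and>
     ivar s' ''best'' \<in> {1..card (edges I)} \<and> input_edge s (ivar s' ''best'') = e \<and>
     ivar s' ''x1'' = m1 e \<and> ivar s' ''x2'' = m2 e"

end

(*
  Correctness of the edge deletion method: for a fixed edge the balance term does not depend on the
  facilities, so 1-medians of both sides minimize the objective.

  Running time: number the vertices along a search order in which parents precede children. For a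
  fixed facility x, one top-down pass yields all distances from x, and one bottom-up pass yields, for
  every subtree at once, the cost of serving it from x. Deleting the edge above j leaves the subtree
  of j and its complement, and the cost of serving the complement is the total minus that of the
  subtree. Hence linear time per x suffices to offer x as a candidate to the relevant side of every
  edge, and all 1-medians of all 2(n-1) subtrees are found in quadratic time.
*)
theory Submission
  imports Defs
begin

section \<open>Optimality of the edge deletion method\<close>

text \<open>The order itself is obtained from an unordered edge list, without adjacency lists, by
  sweeping over all edges \<open>n\<close> times. A sweep that places no vertex has seen no edge
  leaving the set of placed vertices, so this set is closed under adjacency and, by connectedness,
  is everything; hence each sweep makes progress until the search is complete, at total cost
  proportional to \<open>n * m\<close>. The identity that carries both halves of the proof is
  \<open>tdist_edge\<close>: crossing the edge above \<open>j\<close> changes the distance from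
  \<open>x\<close> by exactly its length, and the sign tells whether \<open>x\<close> lies below
  \<open>j\<close>. On the mathematical side it makes the tree distance a potential that bounds
  every path from below. On the program side it is the update of the top-down pass for an arbitrary
  facility \<open>x\<close>, not only for the root. Correctness is carried out on positions, where
  subtrees, paths and distances are recursive functions of the parent array alone, and is
  transferred to vertices and edges only at the end.\<close>

lemma f_pmed_commute: "f_pmed I T1 T2 x1 x2 = f_pmed I T2 T1 x2 x1"
  by (simp add: f_pmed_def add.commute abs_minus_commute)

lemma f_pmed_mono:
  assumes "0 \<le> lam I" "one_median I T1 m1" "one_median I T2 m2" "x1 \<in> T1" "x2 \<in> T2"
  shows "f_pmed I T1 T2 m1 m2 \<le> f_pmed I T1 T2 x1 x2"
  using assms unfolding f_pmed_def one_median_def median_cost_def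
  by (auto intro!: mult_left_mono add_mono)

lemma edge_deletion_run_optimal:
  assumes "valid_instance I" and run: "edge_deletion_run I T1 T2 m1 m2 e"
  shows "optimal I e (T1 e) (T2 e) (m1 e) (m2 e)"
proof -
  have lam: "0 \<le> lam I"
    using assms(1) by (simp add: valid_instance_def)
  have "f_pmed I (T1 e) (T2 e) (m1 e) (m2 e) \<le> f_pmed I S1 S2 x1 x2"
    if "feasible I e' S1 S2 x1 x2" for e' S1 S2 x1 x2
  proof -
    have e': "e' \<in> edges I" and S: "{S1, S2} = {T1 e', T2 e'}" and x: "x1 \<in> S1" "x2 \<in> S2"
      using that run by (auto simp: feasible_def splits_def edge_deletion_run_def)
    have med: "one_median I (T1 e') (m1 e')" "one_median I (T2 e') (m2 e')"
      using run e' by (auto simp: edge_deletion_run_def)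
    have "f_pmed I (T1 e) (T2 e) (m1 e) (m2 e) \<le> f_pmed I (T1 e') (T2 e') (m1 e') (m2 e')"
      using run e' by (simp add: edge_deletion_run_def)
    also have "\<dots> \<le> f_pmed I S1 S2 x1 x2"
    proof (cases "S1 = T1 e'")
      case True
      then have "S2 = T2 e'" using S by (auto simp: doubleton_eq_iff)
      then show ?thesis using True x f_pmed_mono[OF lam med] by simp
    next
      \<comment> \<open>A feasible solution may name the two components in the opposite order;
        \<open>f_pmed\<close> is symmetric under exchanging the sides together with their
        facilities.\<close>
      case False
      then have "S1 = T2 e'" "S2 = T1 e'" using S by (auto simp: doubleton_eq_iff)
      then show ?thesis
        using x f_pmed_mono[OF lam med] f_pmed_commute[of I S1] by simp
    qed
    finally show ?thesis .
  qed
  then show ?thesis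
    using run unfolding optimal_def feasible_def edge_deletion_run_def one_median_def by blast
qed

section \<open>Path lengths\<close>

lemma path_length_Cons:
  "xs \<noteq> [] \<Longrightarrow> path_length len (x # xs) = len {x, hd xs} + path_length len xs"
  by (cases xs) (simp_all add: path_length_def)

lemma path_length_snoc:
  "xs \<noteq> [] \<Longrightarrow> path_length len (xs @ [y]) = path_length len xs + len {last xs, y}"
proof (induction xs)
  case (Cons x xs)
  then show ?case
    by (cases "xs = []") (simp_all add: path_length_Cons, simp add: path_length_def)
qed simp

text \<open>The edgewise inequality telescopes along the path. With \<open>h\<close> the tree
  distance from a fixed start it bounds the length of every path from below.\<close>

lemma path_length_ge_potential:
  assumes "\<And>u v. {u, v} \<in> E \<Longrightarrow> h v \<le> h u + len {u, v}"
    and "successively (\<lambda>x y. {x, y} \<in> E) xs" "xs \<noteq> []"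
  shows "h (last xs) \<le> h (hd xs) + path_length len xs"
  using assms(2,3)
proof (induction xs)
  case (Cons x xs)
  then show ?case
    using assms(1)[of x "hd xs"]
    by (cases "xs = []") (auto simp: path_length_Cons successively_Cons, simp add: path_length_def)
qed simp

lemma successively_invariant:
  assumes "successively R xs" "\<And>x y. R x y \<Longrightarrow> P x \<Longrightarrow> P y" "xs \<noteq> []" "P (hd xs)"
  shows "P (last xs)"
  using assms(1,3,4)
proof (induction xs)
  case (Cons x xs)
  then show ?case
    using assms(2)[of x "hd xs"] by (cases "xs = []") (auto simp: successively_Cons)
qed simp

section \<open>Trees numbered along a search order\<close>

text \<open>
  Vertices are addressed by their position in the order, the root being position 1, and
  \<open>p j\<close> is the position of the parent of position \<open>j\<close>. The minimum with the predecessor only makes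
  the recursions terminate for arbitrary \<open>p\<close>. \<open>proj p q i\<close> is the lowest ancestor of \<open>i\<close> among the
  positions up to \<open>q\<close>; hence \<open>i\<close> lies in the subtree of \<open>q\<close> iff \<open>proj p q i = q\<close>.
\<close>

function proj :: "(nat \<Rightarrow> nat) \<Rightarrow> nat \<Rightarrow> nat \<Rightarrow> nat" where
  "proj p q i = (if i \<le> q then i else proj p q (min (p i) (i - 1)))"
  by auto
termination by (relation "measure (\<lambda>(p, q, i). i)") auto

text \<open>Parents have smaller positions, so the larger of two distinct positions is never an
  ancestor of the smaller one, and the path between them uses its parent edge. Hence the larger
  endpoint is the one to move up, here and in \<open>tpath\<close>.\<close>

function tdist :: "(nat \<Rightarrow> nat) \<Rightarrow> (nat \<Rightarrow> real) \<Rightarrow> nat \<Rightarrow> nat \<Rightarrow> real" where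
  "tdist p l x y =
     (if x < y then tdist p l x (min (p y) (y - 1)) + l y
      else if y < x then tdist p l (min (p x) (x - 1)) y + l x else 0)"
  by auto
termination by (relation "measure (\<lambda>(p, l, x, y). x + y)") auto

function tpath :: "(nat \<Rightarrow> nat) \<Rightarrow> nat \<Rightarrow> nat \<Rightarrow> nat list" where
  "tpath p x y =
     (if x < y then tpath p x (min (p y) (y - 1)) @ [y]
      else if y < x then x # tpath p (min (p x) (x - 1)) y else [x])"
  by auto
termination by (relation "measure (\<lambda>(p, x, y). x + y)") auto

declare proj.simps [simp del] tdist.simps [simp del] tpath.simps [simp del]

definition subtree :: "(nat \<Rightarrow> nat) \<Rightarrow> nat \<Rightarrow> nat \<Rightarrow> nat set" where
  "subtree p n j = {i \<in> {1..n}. proj p j i = j}"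

lemma proj_le: "i \<le> q \<Longrightarrow> proj p q i = i"
  by (simp add: proj.simps)

text \<open>Lowering the cutoff by one affects only the positions that had stopped at
  \<open>Suc q\<close>; they move on to its parent. This is one step of the bottom-up pass.\<close>

lemma proj_Suc:
  "proj p q i = (if proj p (Suc q) i = Suc q then min (p (Suc q)) q else proj p (Suc q) i)"
proof (induction i rule: less_induct)
  case (less i)
  consider "i \<le> q" | "i = Suc q" | "i > Suc q" by linarith
  then show ?case
  proof cases
    case 2
    then show ?thesis by (simp add: proj.simps[of p q "Suc q"] proj_le)
  next
    case 3
    then show ?thesis
      using less.IH[of "min (p i) (i - 1)"] proj.simps[of p q i] proj.simps[of p "Suc q" i] by simp
  qed (simp add: proj_le)
qed

lemma tdist_self [simp]: "tdist p l x x = 0"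
  by (simp add: tdist.simps)

lemma tdist_commute: "tdist p l x y = tdist p l y x"
proof (induction "x + y" arbitrary: x y rule: less_induct)
  case less
  show ?case
    using less[of x "min (p y) (y - 1)"] less[of "min (p x) (x - 1)" y]
      tdist.simps[of p l x y] tdist.simps[of p l y x]
    by (cases x y rule: linorder_cases) auto
qed

locale parents =
  fixes n :: nat and p :: "nat \<Rightarrow> nat"
  assumes parent: "2 \<le> j \<Longrightarrow> j \<le> n \<Longrightarrow> 1 \<le> p j \<and> p j < j"
begin

lemma min_parent: "2 \<le> j \<Longrightarrow> j \<le> n \<Longrightarrow> min (p j) (j - 1) = p j"
  using parent[of j] by linarith

lemma proj_parent: "1 \<le> q \<Longrightarrow> q < i \<Longrightarrow> i \<le> n \<Longrightarrow> proj p q i = proj p q (p i)"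
  using min_parent[of i] proj.simps[of p q i] by simp

lemma proj_range: "1 \<le> q \<Longrightarrow> 1 \<le> i \<Longrightarrow> i \<le> n \<Longrightarrow> proj p q i \<in> {1..q}"
proof (induction i rule: less_induct)
  case (less i)
  then show ?case
    using less.IH[of "p i"] parent[of i] proj_parent[of q i]
    by (cases "i \<le> q") (auto simp: proj_le)
qed

lemma subtree_root: "subtree p n 1 = {1..n}"
  using proj_range[of 1] by (force simp: subtree_def)

text \<open>The edge above \<open>j\<close> is the only one that leaves the subtree of
  \<open>j\<close>: for \<open>i < j\<close> neither end lies in it, and for \<open>j < i\<close>
  the projection of \<open>i\<close> passes through \<open>p i\<close>.\<close>

lemma subtree_parent:
  assumes "1 \<le> j" "2 \<le> i" "i \<le> n" "i \<noteq> j"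
  shows "i \<in> subtree p n j \<longleftrightarrow> p i \<in> subtree p n j"
  using assms parent[of i] proj_parent[of j i] proj_le[of i j] proj_le[of "p i" j]
  by (cases "j < i") (auto simp: subtree_def)

lemma subtree_self: "1 \<le> j \<Longrightarrow> j \<le> n \<Longrightarrow> j \<in> subtree p n j"
  by (simp add: subtree_def proj_le)

lemma subtree_ge: "i \<in> subtree p n j \<Longrightarrow> j \<le> i"
  by (cases "i \<le> j") (auto simp: subtree_def proj_le)

lemma subtree_subset: "subtree p n j \<subseteq> {1..n}"
  by (auto simp: subtree_def)

lemma tdist_parent1: "1 \<le> x \<Longrightarrow> x < y \<Longrightarrow> y \<le> n \<Longrightarrow> tdist p l x y = tdist p l x (p y) + l y"
  using min_parent[of y] tdist.simps[of p l x y] by simp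

lemma tdist_parent2: "1 \<le> y \<Longrightarrow> y < x \<Longrightarrow> x \<le> n \<Longrightarrow> tdist p l x y = tdist p l (p x) y + l x"
  using min_parent[of x] tdist.simps[of p l x y] by simp

text \<open>For \<open>j < x\<close>, moving \<open>x\<close> to its parent shortens both distances
  by the same \<open>l x\<close> and keeps \<open>x\<close> on its side of the edge, so the
  induction descends to \<open>x = j\<close> or \<open>x < j\<close>, where the sign is read
  off.\<close>

lemma tdist_edge:
  assumes j: "2 \<le> j" "j \<le> n" and x: "1 \<le> x" "x \<le> n"
  shows "tdist p l x (p j) = tdist p l x j + (if x \<in> subtree p n j then l j else - l j)"
  using x
proof (induction x rule: less_induct)
  case (less x)
  consider "x < j" | "x = j" | "j < x" by linarith
  then show ?case
  proof cases
    case 1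
    then have "x \<notin> subtree p n j" using subtree_ge by force
    then show ?thesis using 1 less.prems j tdist_parent1[of x j l] by simp
  next
    case 2
    then show ?thesis using j parent[of j] tdist_parent2[of "p j" j l] subtree_self[of j] by simp
  next
    case 3
    then show ?thesis
      using less j parent[of j] parent[of x] tdist_parent2[of "p j" x l] tdist_parent2[of j x l]
        subtree_parent[of j x]
      by simp
  qed
qed

text \<open>\<open>j\<close> stands for one forbidden edge, and \<open>R\<close> for any relation
  that holds along all other parent edges. The bound \<open>max x y\<close> is what yields
  distinctness: the endpoint just stripped exceeds every position on the rest of the path.\<close>

lemma tpath_props:
  assumes "1 \<le> j" and "1 \<le> x" "x \<le> n" "1 \<le> y" "y \<le> n"
    and "x \<in> subtree p n j \<longleftrightarrow> y \<in> subtree p n j"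
    and step: "\<And>i. 2 \<le> i \<Longrightarrow> i \<le> n \<Longrightarrow> i \<noteq> j \<Longrightarrow> R (p i) i \<and> R i (p i)"
  shows "tpath p x y \<noteq> [] \<and> hd (tpath p x y) = x \<and> last (tpath p x y) = y \<and>
    distinct (tpath p x y) \<and> set (tpath p x y) \<subseteq> {1..max x y} \<and> successively R (tpath p x y)"
  using assms(2-6)
proof (induction "x + y" arbitrary: x y rule: less_induct)
  case less
  consider "x < y" | "y < x" | "x = y" by linarith
  then show ?case
  proof cases
    case 1
    have py: "1 \<le> p y" "p y < y" using 1 less.prems parent[of y] by auto
    \<comment> \<open>If \<open>y = j\<close>, then \<open>y\<close> and therefore \<open>x\<close>
      would lie in the subtree of \<open>j\<close>, forcing \<open>x \<ge> y\<close>. So the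
      forbidden edge is never taken.\<close>
    have "y \<noteq> j" using 1 less.prems subtree_ge[of x y] subtree_self[of y] by auto
    then have st: "R (p y) y" and sub: "y \<in> subtree p n j \<longleftrightarrow> p y \<in> subtree p n j"
      using step[of y] 1 less.prems subtree_parent[of j y] \<open>1 \<le> j\<close> by simp_all
    have eq: "tpath p x y = tpath p x (p y) @ [y]"
      using 1 less.prems min_parent[of y] tpath.simps[of p x y] by simp
    have IH: "tpath p x (p y) \<noteq> []" "hd (tpath p x (p y)) = x" "last (tpath p x (p y)) = p y"
      "distinct (tpath p x (p y))" "set (tpath p x (p y)) \<subseteq> {1..max x (p y)}"
      "successively R (tpath p x (p y))"
      using less.hyps[of x "p y"] less.prems py sub by auto
    show ?thesis
      using IH 1 py st less.prems unfolding eq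
      by (auto simp: successively_append_iff dest!: subsetD[OF IH(5)])
  next
    case 2
    have px: "1 \<le> p x" "p x < x" using 2 less.prems parent[of x] by auto
    have "x \<noteq> j" using 2 less.prems subtree_ge[of y x] subtree_self[of x] by auto
    then have st: "R x (p x)" and sub: "x \<in> subtree p n j \<longleftrightarrow> p x \<in> subtree p n j"
      using step[of x] 2 less.prems subtree_parent[of j x] \<open>1 \<le> j\<close> by simp_all
    have eq: "tpath p x y = x # tpath p (p x) y"
      using 2 less.prems min_parent[of x] tpath.simps[of p x y] by simp
    have IH: "tpath p (p x) y \<noteq> []" "hd (tpath p (p x) y) = p x" "last (tpath p (p x) y) = y"
      "distinct (tpath p (p x) y)" "set (tpath p (p x) y) \<subseteq> {1..max (p x) y}"
      "successively R (tpath p (p x) y)"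
      using less.hyps[of "p x" y] less.prems px sub by auto
    show ?thesis
      using IH 2 px st less.prems unfolding eq
      by (auto simp: successively_Cons dest!: subsetD[OF IH(5)])
  next
    case 3
    then show ?thesis using less.prems by (simp add: tpath.simps)
  qed
qed

end

text \<open>Only the inclusion of the parent edges in \<open>E\<close> is assumed; that they exhaust
  \<open>E\<close> is derived from acyclicity in \<open>edges_eq\<close>.\<close>

locale search_order = parents n p for n p +
  fixes V :: "'a set" and E :: "'a set set" and ord :: "nat \<Rightarrow> 'a"
  assumes tree: "is_tree V E"
    and bij: "bij_betw ord {1..n} V"
    and edge: "2 \<le> j \<Longrightarrow> j \<le> n \<Longrightarrow> {ord j, ord (p j)} \<in> E"
begin

abbreviation pedge :: "nat \<Rightarrow> 'a set" where "pedge j \<equiv> {ord j, ord (p j)}"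

lemma ord_eq_iff: "i \<in> {1..n} \<Longrightarrow> j \<in> {1..n} \<Longrightarrow> ord i = ord j \<longleftrightarrow> i = j"
  using inj_on_eq_iff[OF bij_betw_imp_inj_on[OF bij]] by blast

lemma ord_image: "ord ` {1..n} = V"
  using bij by (simp add: bij_betw_def)

lemma tpath_is_path:
  assumes "x \<in> {1..n}" "y \<in> {1..n}" "1 \<le> j"
    and "x \<in> subtree p n j \<longleftrightarrow> y \<in> subtree p n j"
    and "\<And>i. 2 \<le> i \<Longrightarrow> i \<le> n \<Longrightarrow> i \<noteq> j \<Longrightarrow> pedge i \<in> F"
  shows "is_path V F (ord x) (map ord (tpath p x y)) (ord y)"
proof -
  have props: "tpath p x y \<noteq> [] \<and> hd (tpath p x y) = x \<and> last (tpath p x y) = y \<and>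
      distinct (tpath p x y) \<and> set (tpath p x y) \<subseteq> {1..max x y} \<and>
      successively (\<lambda>i k. {ord i, ord k} \<in> F) (tpath p x y)"
    using assms by (intro tpath_props[of j]) (auto simp: insert_commute)
  moreover have sub: "set (tpath p x y) \<subseteq> {1..n}"
    using props assms(1,2) by force
  moreover have "inj_on ord (set (tpath p x y))"
    using sub bij by (meson bij_betw_def inj_on_subset)
  ultimately show ?thesis
    using ord_image by (auto simp: is_path_def hd_map last_map distinct_map successively_map)
qed

text \<open>Forbidding the edge above \<open>Suc n\<close> forbids nothing: no position up to
  \<open>n\<close> projects to \<open>Suc n\<close>, so all of them lie on the same side.\<close>

lemma tpath_is_path_all:
  assumes "x \<in> {1..n}" "y \<in> {1..n}"
  shows "is_path V E (ord x) (map ord (tpath p x y)) (ord y)"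
proof -
  have "x \<notin> subtree p n (Suc n)" "y \<notin> subtree p n (Suc n)"
    using subtree_ge[of _ "Suc n"] assms by force+
  then show ?thesis
    using assms edge by (intro tpath_is_path[of x y "Suc n" E]) auto
qed

lemma tpath_ends:
  assumes "x \<in> {1..n}" "y \<in> {1..n}"
  shows "tpath p x y \<noteq> []" "hd (tpath p x y) = x" "last (tpath p x y) = y"
proof -
  have "x \<notin> subtree p n (Suc n)" "y \<notin> subtree p n (Suc n)"
    using subtree_ge[of _ "Suc n"] assms by force+
  then show "tpath p x y \<noteq> []" "hd (tpath p x y) = x" "last (tpath p x y) = y"
    using tpath_props[of "Suc n" x y "\<lambda>_ _. True"] assms by auto
qed

lemma edges_eq: "E = pedge ` {2..n}"
proof
  show "pedge ` {2..n} \<subseteq> E" using edge by auto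
  show "E \<subseteq> pedge ` {2..n}"
  proof
    fix e assume e: "e \<in> E"
    then have "e \<subseteq> V" "card e = 2" using tree by (auto simp: is_tree_def)
    then obtain u v where uv: "e = {u, v}" "u \<noteq> v" "u \<in> V" "v \<in> V"
      by (auto simp: card_2_iff)
    then obtain a b where ab: "u = ord a" "v = ord b" "a \<in> {1..n}" "b \<in> {1..n}"
      unfolding ord_image[symmetric] by blast
    obtain x y where xy: "e = {ord x, ord y}" "x \<in> {1..n}" "y \<in> {1..n}" "x < y"
    proof (cases a b rule: linorder_cases)
      case less
      then show ?thesis using that[of a b] uv ab by simp
    next
      case greater
      then show ?thesis using that[of b a] uv ab by (simp add: insert_commute)
    qed (use uv ab in simp)
    have py: "1 \<le> p y" "p y < y" using xy parent[of y] by auto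
    have "p y = x"
    \<comment> \<open>Otherwise the tree path from \<open>x\<close> to \<open>p y\<close> has at
      least two vertices; extended by \<open>y\<close> and closed by the edge \<open>e\<close> it is
      a cycle.\<close>
    proof (rule ccontr)
      assume "p y \<noteq> x"
      moreover have "tpath p x (p y) \<noteq> []" "hd (tpath p x (p y)) = x" "last (tpath p x (p y)) = p y"
        using tpath_ends[of x "p y"] xy py by auto
      ultimately have "2 \<le> length (tpath p x (p y))"
        by (cases "tpath p x (p y)"; cases "tl (tpath p x (p y))") auto
      moreover have "tpath p x y = tpath p x (p y) @ [y]"
        using xy min_parent[of y] tpath.simps[of p x y] by simp
      ultimately have "3 \<le> length (map ord (tpath p x y))" by simp
      moreover have "is_path V E (ord x) (map ord (tpath p x y)) (ord y)"
        using tpath_is_path_all xy by simp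
      ultimately have "is_cycle V E (map ord (tpath p x y))"
        using e xy(1) by (auto simp: is_cycle_def is_path_def insert_commute)
      then show False using tree by (auto simp: is_tree_def)
    qed
    then show "e \<in> pedge ` {2..n}" using xy py by (auto simp: insert_commute)
  qed
qed

lemma edgeE:
  assumes "e \<in> E"
  obtains j where "j \<in> {2..n}" "e = pedge j"
proof -
  have "e \<in> pedge ` {2..n}" using assms edges_eq by simp
  then show thesis by (elim imageE) (rule that)
qed

lemma pedge_inj: "inj_on pedge {2..n}"
proof (rule inj_onI)
  fix i j assume ij: "i \<in> {2..n}" "j \<in> {2..n}" "pedge i = pedge j"
  have "1 \<le> p i" "p i < i" "1 \<le> p j" "p j < j" using ij parent[of i] parent[of j] by auto
  then show "i = j"
    using ij ord_eq_iff[of i j] ord_eq_iff[of i "p j"] ord_eq_iff[of "p i" j]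
    by (auto simp: doubleton_eq_iff)
qed

lemma path_length_tpath:
  assumes "x \<in> {1..n}" "y \<in> {1..n}"
  shows "path_length len (map ord (tpath p x y)) = tdist p (\<lambda>j. len (pedge j)) x y"
  using assms
proof (induction "x + y" arbitrary: x y rule: less_induct)
  case less
  consider "x < y" | "y < x" | "x = y" by linarith
  then show ?case
  proof cases
    case 1
    then have py: "1 \<le> p y" "p y < y" using parent[of y] less.prems by auto
    have eq: "tpath p x y = tpath p x (p y) @ [y]"
      using 1 less.prems min_parent[of y] tpath.simps[of p x y] by simp
    note ends = tpath_ends[of x "p y"]
    have "path_length len (map ord (tpath p x y)) =
        path_length len (map ord (tpath p x (p y))) + len {ord (p y), ord y}"
      unfolding eq map_append list.map
      by (subst path_length_snoc; use ends py less.prems in \<open>simp add: last_map\<close>)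
    also have "path_length len (map ord (tpath p x (p y))) = tdist p (\<lambda>j. len (pedge j)) x (p y)"
      by (rule less.hyps) (use less.prems py in auto)
    also have "len {ord (p y), ord y} = len (pedge y)"
      by (simp add: insert_commute)
    also have "tdist p (\<lambda>j. len (pedge j)) x (p y) + len (pedge y) =
        tdist p (\<lambda>j. len (pedge j)) x y"
      by (rule tdist_parent1[symmetric]) (use less.prems 1 in auto)
    finally show ?thesis .
  next
    case 2
    then have px: "1 \<le> p x" "p x < x" using parent[of x] less.prems by auto
    have eq: "tpath p x y = x # tpath p (p x) y"
      using 2 less.prems min_parent[of x] tpath.simps[of p x y] by simp
    note ends = tpath_ends[of "p x" y]
    have "path_length len (map ord (tpath p x y)) =
        len (pedge x) + path_length len (map ord (tpath p (p x) y))"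
      unfolding eq list.map
      by (subst path_length_Cons; use ends px less.prems in \<open>simp add: hd_map\<close>)
    also have "path_length len (map ord (tpath p (p x) y)) = tdist p (\<lambda>j. len (pedge j)) (p x) y"
      by (rule less.hyps) (use less.prems px in auto)
    also have "len (pedge x) + tdist p (\<lambda>j. len (pedge j)) (p x) y =
        tdist p (\<lambda>j. len (pedge j)) x y"
      by (subst tdist_parent2[of y x]) (use less.prems 2 in auto)
    finally show ?thesis .
  next
    case 3
    then show ?thesis by (simp add: tpath.simps path_length_def)
  qed
qed

text \<open>
  The tree distance from \<open>x\<close> changes by at most the length of an edge along that edge, so no path
  is shorter.
\<close>

lemma sp_dist_eq_tdist:
  assumes len: "\<And>e. e \<in> E \<Longrightarrow> 0 \<le> len e" and xy: "x \<in> {1..n}" "y \<in> {1..n}"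
  shows "sp_dist V E len (ord x) (ord y) = tdist p (\<lambda>j. len (pedge j)) x y"
    (is "_ = tdist p ?l x y")
  unfolding sp_dist_def
proof (rule cInf_eq_minimum)
  show "tdist p ?l x y \<in> path_length len ` {xs. is_path V E (ord x) xs (ord y)}"
    using tpath_is_path_all[OF xy] path_length_tpath[OF xy, of len] by (auto simp: image_iff)
next
  fix r assume "r \<in> path_length len ` {xs. is_path V E (ord x) xs (ord y)}"
  then obtain xs where r: "r = path_length len xs" and xs: "is_path V E (ord x) xs (ord y)"
    by auto
  define h where "h v = tdist p ?l x (the_inv_into {1..n} ord v)" for v
  have h: "h (ord j) = tdist p ?l x j" if "j \<in> {1..n}" for j
    using that bij by (simp add: h_def bij_betw_def the_inv_into_f_f)
  have "h v \<le> h u + len {u, v}" if uv: "{u, v} \<in> E" for u v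
  proof -
    obtain j where j: "j \<in> {2..n}" "{u, v} = pedge j"
      using edgeE[OF uv] by blast
    have "1 \<le> p j" "p j < j" using parent[of j] j by auto
    then have "h (ord (p j)) = h (ord j) + ?l j \<or> h (ord (p j)) = h (ord j) - ?l j"
      using h[of j] h[of "p j"] tdist_edge[of j x ?l] j xy by auto
    moreover have "0 \<le> ?l j" using len edge j by simp
    ultimately show ?thesis using j(2) by (auto simp: doubleton_eq_iff insert_commute)
  qed
  from path_length_ge_potential[of E h, OF this, of xs] show "tdist p ?l x y \<le> r"
    using xs r h xy by (simp add: is_path_def)
qed

text \<open>Positions on the same side are joined by \<open>tpath\<close>, which avoids the deleted
  edge. Conversely, by \<open>subtree_parent\<close>, membership in the subtree is invariant along
  each remaining edge. The positions \<open>j\<close> and 1 show that both sides are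
  inhabited.\<close>

lemma components_delete:
  assumes j: "2 \<le> j" "j \<le> n"
  shows "components V (E - {pedge j}) = {ord ` subtree p n j, ord ` ({1..n} - subtree p n j)}"
proof -
  let ?F = "E - {pedge j}" and ?S = "subtree p n j"
  have F: "pedge i \<in> ?F" if "2 \<le> i" "i \<le> n" "i \<noteq> j" for i
    using that j edge[of i] inj_onD[OF pedge_inj, of i j] by auto
  have reach: "{u. \<exists>xs. is_path V ?F (ord x) xs u} = ord ` {y \<in> {1..n}. y \<in> ?S \<longleftrightarrow> x \<in> ?S}"
    (is "?L = ?R") if x: "x \<in> {1..n}" for x
  proof
    show "?R \<subseteq> ?L"
    proof
      fix u assume "u \<in> ?R"
      then obtain y where y: "u = ord y" "y \<in> {1..n}" "x \<in> ?S \<longleftrightarrow> y \<in> ?S" by auto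
      have "is_path V ?F (ord x) (map ord (tpath p x y)) (ord y)"
        using x y j F by (intro tpath_is_path[of x y j]) auto
      then show "u \<in> ?L" using y by blast
    qed
    show "?L \<subseteq> ?R"
    proof
      fix u assume "u \<in> ?L"
      then obtain xs where xs: "is_path V ?F (ord x) xs u" by auto
      have step: "b \<in> ?R" if ab: "{a, b} \<in> ?F" and "a \<in> ?R" for a b
      proof -
        obtain i where i: "i \<in> {2..n}" "{a, b} = pedge i" "i \<noteq> j"
        proof (rule edgeE)
          show "{a, b} \<in> E" using ab by simp
        qed (use ab that in auto)
        have pi: "1 \<le> p i" "p i < i" using parent[of i] i by auto
        obtain k where k: "k \<in> {1..n}" "a = ord k" "k \<in> ?S \<longleftrightarrow> x \<in> ?S" using \<open>a \<in> ?R\<close> by auto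
        have iff: "i \<in> ?S \<longleftrightarrow> p i \<in> ?S" using subtree_parent[of j i] i j by simp
        from i(2) consider "a = ord i" "b = ord (p i)" | "a = ord (p i)" "b = ord i"
          by (auto simp: doubleton_eq_iff)
        then show ?thesis
        proof cases
          case 1
          then have "k = i" using ord_eq_iff[of k i] k i by simp
          then show ?thesis using 1 iff k pi i by auto
        next
          case 2
          then have "k = p i" using ord_eq_iff[of k "p i"] k i pi by simp
          then show ?thesis using 2 iff k pi i by auto
        qed
      qed
      have "last xs \<in> ?R"
        by (rule successively_invariant[where R = "\<lambda>a b. {a, b} \<in> ?F" and P = "\<lambda>v. v \<in> ?R"])
          (use xs x step in \<open>auto simp: is_path_def\<close>)
      then show "u \<in> ?R" using xs by (simp add: is_path_def)
    qed
  qed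
  have "components V ?F = (\<lambda>x. ord ` {y \<in> {1..n}. y \<in> ?S \<longleftrightarrow> x \<in> ?S}) ` {1..n}"
    unfolding components_def ord_image[symmetric] image_image
    using reach ord_image by (intro image_cong) auto
  also have "\<dots> = {ord ` ?S, ord ` ({1..n} - ?S)}"
  proof -
    have "ord ` {y \<in> {1..n}. y \<in> ?S \<longleftrightarrow> x \<in> ?S} =
        (if x \<in> ?S then ord ` ?S else ord ` ({1..n} - ?S))" for x
      using subtree_subset[of j] by (auto intro!: arg_cong[of _ _ "(`) ord"])
    moreover have "j \<in> ?S" "1 \<notin> ?S" using subtree_self[of j] subtree_ge[of 1 j] j by auto
    ultimately show ?thesis using j by (auto simp: image_iff)
  qed
  finally show ?thesis .
qed

lemma subtree_images_neq:
  assumes "2 \<le> j" "j \<le> n"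
  shows "ord ` subtree p n j \<noteq> ord ` ({1..n} - subtree p n j)"
proof -
  have "ord j \<in> ord ` subtree p n j" using subtree_self assms by simp
  moreover have "ord j \<notin> ord ` ({1..n} - subtree p n j)"
  proof
    assume "ord j \<in> ord ` ({1..n} - subtree p n j)"
    then obtain x where "ord j = ord x" "x \<in> {1..n}" "x \<notin> subtree p n j" by blast
    then show False using ord_eq_iff[of j x] subtree_self[of j] assms by simp
  qed
  ultimately show ?thesis by metis
qed

end

section \<open>Total correctness with cost bounds\<close>

text \<open>Existence of an execution includes termination, and \<open>exec\<close> is
  deterministic, so this is total correctness with \<open>k\<close> as an upper bound on the
  cost.\<close>

definition runs :: "com \<Rightarrow> state \<Rightarrow> nat \<Rightarrow> (state \<Rightarrow> bool) \<Rightarrow> bool" where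
  "runs c s k Q \<longleftrightarrow> (\<exists>k' s'. exec c s k' s' \<and> k' \<le> k \<and> Q s')"

primrec ivars_mod :: "com \<Rightarrow> string set" where
  "ivars_mod Skip = {}"
| "ivars_mod (ISet x a) = {x}"
| "ivars_mod (IStore x i a) = {}"
| "ivars_mod (RSet x a) = {}"
| "ivars_mod (RStore x i a) = {}"
| "ivars_mod (Seq c d) = ivars_mod c \<union> ivars_mod d"
| "ivars_mod (Cond b c d) = ivars_mod c \<union> ivars_mod d"
| "ivars_mod (While b c) = ivars_mod c"

primrec iarrs_mod :: "com \<Rightarrow> string set" where
  "iarrs_mod Skip = {}"
| "iarrs_mod (ISet x a) = {}"
| "iarrs_mod (IStore x i a) = {x}"
| "iarrs_mod (RSet x a) = {}"
| "iarrs_mod (RStore x i a) = {}"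
| "iarrs_mod (Seq c d) = iarrs_mod c \<union> iarrs_mod d"
| "iarrs_mod (Cond b c d) = iarrs_mod c \<union> iarrs_mod d"
| "iarrs_mod (While b c) = iarrs_mod c"

primrec rvars_mod :: "com \<Rightarrow> string set" where
  "rvars_mod Skip = {}"
| "rvars_mod (ISet x a) = {}"
| "rvars_mod (IStore x i a) = {}"
| "rvars_mod (RSet x a) = {x}"
| "rvars_mod (RStore x i a) = {}"
| "rvars_mod (Seq c d) = rvars_mod c \<union> rvars_mod d"
| "rvars_mod (Cond b c d) = rvars_mod c \<union> rvars_mod d"
| "rvars_mod (While b c) = rvars_mod c"

primrec rarrs_mod :: "com \<Rightarrow> string set" where
  "rarrs_mod Skip = {}"
| "rarrs_mod (ISet x a) = {}"
| "rarrs_mod (IStore x i a) = {}"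
| "rarrs_mod (RSet x a) = {}"
| "rarrs_mod (RStore x i a) = {x}"
| "rarrs_mod (Seq c d) = rarrs_mod c \<union> rarrs_mod d"
| "rarrs_mod (Cond b c d) = rarrs_mod c \<union> rarrs_mod d"
| "rarrs_mod (While b c) = rarrs_mod c"

text \<open>Unchanged memory is read off the program text, at the granularity of whole arrays, so
  that invariants have to mention only what a loop writes.\<close>

definition frame :: "com \<Rightarrow> state \<Rightarrow> state \<Rightarrow> bool" where
  "frame c s s' \<longleftrightarrow>
     (\<forall>x. x \<notin> ivars_mod c \<longrightarrow> ivar s' x = ivar s x) \<and>
     (\<forall>x. x \<notin> iarrs_mod c \<longrightarrow> iarr s' x = iarr s x) \<and>
     (\<forall>x. x \<notin> rvars_mod c \<longrightarrow> rvar s' x = rvar s x) \<and>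
     (\<forall>x. x \<notin> rarrs_mod c \<longrightarrow> rarr s' x = rarr s x)"

lemma frameD:
  assumes "frame c s s'"
  shows "x \<notin> ivars_mod c \<Longrightarrow> ivar s' x = ivar s x"
    and "x \<notin> iarrs_mod c \<Longrightarrow> iarr s' x = iarr s x"
    and "x \<notin> rvars_mod c \<Longrightarrow> rvar s' x = rvar s x"
    and "x \<notin> rarrs_mod c \<Longrightarrow> rarr s' x = rarr s x"
  using assms by (simp_all add: frame_def)

lemma frame_refl: "frame c s s"
  by (simp add: frame_def)

lemma frame_trans:
  assumes "frame c1 s1 s2" "frame c2 s2 s3"
    and "ivars_mod c1 \<union> ivars_mod c2 \<subseteq> ivars_mod c" "iarrs_mod c1 \<union> iarrs_mod c2 \<subseteq> iarrs_mod c"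
    and "rvars_mod c1 \<union> rvars_mod c2 \<subseteq> rvars_mod c" "rarrs_mod c1 \<union> rarrs_mod c2 \<subseteq> rarrs_mod c"
  shows "frame c s1 s3"
proof -
  have "x \<notin> ivars_mod c \<Longrightarrow> x \<notin> ivars_mod c1 \<and> x \<notin> ivars_mod c2"
    "x \<notin> iarrs_mod c \<Longrightarrow> x \<notin> iarrs_mod c1 \<and> x \<notin> iarrs_mod c2"
    "x \<notin> rvars_mod c \<Longrightarrow> x \<notin> rvars_mod c1 \<and> x \<notin> rvars_mod c2"
    "x \<notin> rarrs_mod c \<Longrightarrow> x \<notin> rarrs_mod c1 \<and> x \<notin> rarrs_mod c2" for x
    using assms(3-6) by blast+
  then show ?thesis
    unfolding frame_def by (simp add: frameD[OF assms(1)] frameD[OF assms(2)])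
qed

lemma exec_frame: "exec c s k s' \<Longrightarrow> frame c s s'"
proof (induction rule: exec.induct)
  case (Seq c1 s1 k1 s2 c2 k2 s3)
  show ?case by (rule frame_trans[OF Seq.IH]) auto
next
  case (WhileTrue b s1 c k1 s2 k2 s3)
  show ?case by (rule frame_trans[OF WhileTrue.IH]) auto
qed (auto simp: frame_def)

text \<open>Loop-free programs are interpreted as functions on states, so that the simplifier can run them.\<close>

primrec loop_free :: "com \<Rightarrow> bool" where
  "loop_free Skip = True"
| "loop_free (ISet x a) = True"
| "loop_free (IStore x i a) = True"
| "loop_free (RSet x a) = True"
| "loop_free (RStore x i a) = True"
| "loop_free (Seq c d) = (loop_free c \<and> loop_free d)"
| "loop_free (Cond b c d) = (loop_free c \<and> loop_free d)"
| "loop_free (While b c) = False"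

primrec run :: "com \<Rightarrow> state \<Rightarrow> state" where
  "run Skip s = s"
| "run (ISet x a) s = s\<lparr>ivar := (ivar s)(x := ival a s)\<rparr>"
| "run (IStore x i a) s = s\<lparr>iarr := (iarr s)(x := (iarr s x)(ival i s := ival a s))\<rparr>"
| "run (RSet x a) s = s\<lparr>rvar := (rvar s)(x := rval a s)\<rparr>"
| "run (RStore x i a) s = s\<lparr>rarr := (rarr s)(x := (rarr s x)(ival i s := rval a s))\<rparr>"
| "run (Seq c d) s = run d (run c s)"
| "run (Cond b c d) s = (if bval b s then run c s else run d s)"
| "run (While b c) s = s"

primrec cost :: "com \<Rightarrow> nat" where
  "cost Skip = 1"
| "cost (ISet x a) = icost a + 1"
| "cost (IStore x i a) = icost i + icost a + 1"
| "cost (RSet x a) = rcost a + 1"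
| "cost (RStore x i a) = icost i + rcost a + 1"
| "cost (Seq c d) = cost c + cost d"
| "cost (Cond b c d) = bcost b + 1 + max (cost c) (cost d)"
| "cost (While b c) = 0"

lemma exec_run: "loop_free c \<Longrightarrow> \<exists>k\<le>cost c. exec c s k (run c s)"
proof (induction c arbitrary: s)
  case (Seq c d)
  obtain k1 where k1: "k1 \<le> cost c" "exec c s k1 (run c s)" using Seq by force
  obtain k2 where k2: "k2 \<le> cost d" "exec d (run c s) k2 (run d (run c s))" using Seq by force
  show ?case using exec.Seq[OF k1(2) k2(2)] k1(1) k2(1) by (intro exI[of _ "k1 + k2"]) simp
next
  case (Cond b c d)
  obtain k1 where k1: "k1 \<le> cost c" "exec c s k1 (run c s)" using Cond by force
  obtain k2 where k2: "k2 \<le> cost d" "exec d s k2 (run d s)" using Cond by force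
  show ?case
  proof (cases "bval b s")
    case True
    then show ?thesis
      using CondTrue[OF True k1(2)] k1(1) by (intro exI[of _ "bcost b + 1 + k1"]) simp
  next
    case False
    then show ?thesis
      using CondFalse[OF False k2(2)] k2(1) by (intro exI[of _ "bcost b + 1 + k2"]) simp
  qed
qed (simp_all only: loop_free.simps run.simps cost.simps,
    (metis exec.Skip exec.ISet exec.IStore exec.RSet exec.RStore order_refl)+)

lemma runs_run: "loop_free c \<Longrightarrow> Q (run c s) \<Longrightarrow> cost c \<le> k \<Longrightarrow> runs c s k Q"
  unfolding runs_def using exec_run[of c s] order_trans by blast

lemma runs_Seq:
  assumes "runs c1 s k1 R" "\<And>s'. R s' \<Longrightarrow> frame c1 s s' \<Longrightarrow> runs c2 s' k2 Q" "k1 + k2 \<le> k"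
  shows "runs (Seq c1 c2) s k Q"
proof -
  obtain k1' s1 where 1: "exec c1 s k1' s1" "k1' \<le> k1" "R s1" using assms(1) by (auto simp: runs_def)
  then obtain k2' s2 where 2: "exec c2 s1 k2' s2" "k2' \<le> k2" "Q s2"
    using assms(2)[of s1] exec_frame[of c1] by (auto simp: runs_def)
  show ?thesis
    unfolding runs_def using exec.Seq[OF 1(1) 2(1)] 1(2) 2(2,3) assms(3)
    by (intro exI[of _ "k1' + k2'"] exI[of _ s2]) simp
qed

definition loop :: "string \<Rightarrow> string \<Rightarrow> com \<Rightarrow> com" where
  "loop x b c = Seq (ISet x (IConst 1))
     (While (BNot (ILess (IVar b) (IVar x))) (Seq c (ISet x (IAdd (IVar x) (IConst 1)))))"

lemma loop_mod [simp]:
  "ivars_mod (loop x b c) = insert x (ivars_mod c)" "iarrs_mod (loop x b c) = iarrs_mod c"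
  "rvars_mod (loop x b c) = rvars_mod c" "rarrs_mod (loop x b c) = rarrs_mod c"
  by (auto simp: loop_def)

text \<open>\<open>I i\<close> describes the state after \<open>i\<close> rounds, when the counter
  reads \<open>Suc i\<close>; \<open>counter\<close> is there because the increment follows the
  body. Besides the body a round costs 5 for the test and 4 for the increment; the initial
  assignment costs 2 and the failing test 5, which gives the 7.\<close>

lemma runs_loop:
  assumes names: "x \<notin> ivars_mod c" "b \<notin> ivars_mod c" "b \<noteq> x"
    and init: "I 0 s"
    and counter: "\<And>i s' v. I i s' \<Longrightarrow> I i (s'\<lparr>ivar := (ivar s')(x := v)\<rparr>)"
    and step: "\<And>i s'. i < ivar s b \<Longrightarrow> I i s' \<Longrightarrow> frame (loop x b c) s s' \<Longrightarrow> ivar s' x = Suc i \<Longrightarrow>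
      runs c s' k (I (Suc i))"
    and post: "\<And>s'. I (ivar s b) s' \<Longrightarrow> frame (loop x b c) s s' \<Longrightarrow> Q s'"
    and K: "ivar s b * (k + 9) + 7 \<le> K"
  shows "runs (loop x b c) s K Q"
proof -
  let ?W = "While (BNot (ILess (IVar b) (IVar x))) (Seq c (ISet x (IAdd (IVar x) (IConst 1))))"
  have fr: "frame (loop x b c) s s2" if "frame (loop x b c) s s1" "frame d s1 s2"
    "ivars_mod d \<subseteq> insert x (ivars_mod c)" "iarrs_mod d \<subseteq> iarrs_mod c"
    "rvars_mod d \<subseteq> rvars_mod c" "rarrs_mod d \<subseteq> rarrs_mod c" for s1 s2 d
    using frame_trans[OF that(1,2), of "loop x b c"] that(3-6) by auto
  have "\<exists>k' s''. exec ?W s' k' s'' \<and> k' \<le> (ivar s b - i) * (k + 9) + 5 \<and> I (ivar s b) s'' \<and>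
      frame (loop x b c) s s''"
    if "i \<le> ivar s b" "I i s'" "frame (loop x b c) s s'" "ivar s' x = Suc i" for i s'
    using that
  proof (induction "ivar s b - i" arbitrary: i s')
    case 0
    then have "ivar s' b = ivar s b" "i = ivar s b" using names frameD(1)[of _ s s' b] by auto
    then have "exec ?W s' (bcost (BNot (ILess (IVar b) (IVar x))) + 1) s'"
      using 0 by (intro exec.WhileFalse) simp
    then show ?case using 0 \<open>i = ivar s b\<close> by force
  next
    case (Suc j)
    have b: "ivar s' b = ivar s b" using names frameD(1)[OF Suc.prems(3), of b] by auto
    have lt: "i < ivar s b" using Suc by simp
    obtain k1 s1 where 1: "exec c s' k1 s1" "k1 \<le> k" "I (Suc i) s1"
      using step[OF lt Suc.prems(2-4)] by (auto simp: runs_def)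
    have f1: "frame (loop x b c) s s1"
      by (rule fr[OF Suc.prems(3) exec_frame[OF 1(1)]]) auto
    define s2 where "s2 = s1\<lparr>ivar := (ivar s1)(x := Suc (Suc i))\<rparr>"
    have x1: "ivar s1 x = Suc i" using exec_frame[OF 1(1)] names Suc.prems(4) by (simp add: frame_def)
    have e2: "exec (ISet x (IAdd (IVar x) (IConst 1))) s1 4 s2"
      using exec.ISet[of x "IAdd (IVar x) (IConst 1)" s1] x1 by (simp add: s2_def numeral_eq_Suc)
    have f2: "frame (loop x b c) s s2"
      by (rule fr[OF f1 exec_frame[OF e2]]) auto
    have "\<exists>k' s''. exec ?W s2 k' s'' \<and> k' \<le> (ivar s b - Suc i) * (k + 9) + 5 \<and>
        I (ivar s b) s'' \<and> frame (loop x b c) s s''"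
    proof (rule Suc.hyps(1))
      show "j = ivar s b - Suc i" "Suc i \<le> ivar s b" using Suc.hyps(2) lt by simp_all
      show "I (Suc i) s2" "ivar s2 x = Suc (Suc i)" using counter[OF 1(3)] by (simp_all add: s2_def)
    qed (fact f2)
    then obtain k2 s3 where 3: "exec ?W s2 k2 s3" "k2 \<le> (ivar s b - Suc i) * (k + 9) + 5"
      "I (ivar s b) s3" "frame (loop x b c) s s3"
      by blast
    have "exec ?W s' (bcost (BNot (ILess (IVar b) (IVar x))) + 1 + (k1 + 4) + k2) s3"
      using lt b Suc.prems(4) by (intro exec.WhileTrue[OF _ exec.Seq[OF 1(1) e2] 3(1)]) simp
    moreover have "ivar s b - i = Suc (ivar s b - Suc i)" using lt by simp
    ultimately show ?case
      using 1(2) 3 by (intro exI[of _ "bcost (BNot (ILess (IVar b) (IVar x))) + 1 + (k1 + 4) + k2"]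
        exI[of _ s3]) simp
  qed
  note W = this
  define s1 where "s1 = s\<lparr>ivar := (ivar s)(x := 1)\<rparr>"
  have e1: "exec (ISet x (IConst 1)) s 2 s1"
    using exec.ISet[of x "IConst 1" s] by (simp add: s1_def numeral_2_eq_2)
  have "frame (loop x b c) s s1" by (rule fr[OF frame_refl exec_frame[OF e1]]) auto
  then obtain k2 s2 where "exec ?W s1 k2 s2" "k2 \<le> ivar s b * (k + 9) + 5"
    "I (ivar s b) s2" "frame (loop x b c) s s2"
    using W[of 0 s1] counter[OF init] by (auto simp: s1_def)
  then show ?thesis
    using exec.Seq[OF e1, of ?W k2 s2] post K unfolding runs_def loop_def
    by (intro exI[of _ "2 + k2"] exI[of _ s2]) (auto simp: loop_def)
qed

section \<open>The program\<close>

text \<open>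
  The vertex at position \<open>j\<close> of the search order is \<open>ord[j]\<close>, its parent has position \<open>pp[j]\<close>, and the
  edge between them has input index \<open>ei[j]\<close>. For a fixed candidate facility at position \<open>x\<close>, \<open>mk\<close> marks
  the subtrees containing \<open>x\<close>, \<open>d\<close> holds the distances from \<open>x\<close>, and \<open>acc[j]\<close> is the cost of serving
  the subtree of \<open>j\<close> from \<open>x\<close>; the cost on the other side of the edge above \<open>j\<close> is \<open>acc[1] - acc[j]\<close>.
  \<open>c1\<close> and \<open>c2\<close> are the costs of the best facilities \<open>m1\<close> and \<open>m2\<close> found so far, \<open>dep\<close> holds the
  distances from the root and \<open>zs\<close> the subtree sums of \<open>z\<close>.
\<close>

definition accumulate_body :: "string \<Rightarrow> com" where
  "accumulate_body A = Seq (ISet ''a'' (ISub (IAdd (IVar ''n'') (IConst 1)) (IVar ''i'')))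
     (Cond (ILess (IConst 1) (IVar ''a''))
       (RStore A (IArr ''pp'' (IVar ''a''))
         (RAdd (RArr A (IArr ''pp'' (IVar ''a''))) (RArr A (IVar ''a''))))
       Skip)"

definition accumulate :: "string \<Rightarrow> com" where
  "accumulate A = loop ''i'' ''n'' (accumulate_body A)"

text \<open>Marks are real numbers so that \<open>accumulate\<close> applies to them: summing the
  indicator of \<open>x\<close> over subtrees gives the indicator of the subtrees containing
  \<open>x\<close>.\<close>

definition fill_mark :: com where
  "fill_mark = loop ''i'' ''n''
     (Cond (BAnd (BNot (ILess (IVar ''i'') (IVar ''x''))) (BNot (ILess (IVar ''x'') (IVar ''i''))))
       (RStore ''mk'' (IVar ''i'') (RConst 1)) (RStore ''mk'' (IVar ''i'') (RConst 0)))"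

definition distances_body :: com where
  "distances_body =
     (Seq (Cond (ILess (IConst 1) (IVar ''a''))
       (Cond (RLess (RConst 0) (RArr ''mk'' (IVar ''a'')))
         (RStore ''d'' (IVar ''a'') (RSub (RArr ''d'' (IArr ''pp'' (IVar ''a'')))
           (RArr ''len'' (IArr ''ei'' (IVar ''a'')))))
         (RStore ''d'' (IVar ''a'') (RAdd (RArr ''d'' (IArr ''pp'' (IVar ''a'')))
           (RArr ''len'' (IArr ''ei'' (IVar ''a''))))))
       (RStore ''d'' (IVar ''a'') (RArr ''dep'' (IVar ''x''))))
       (RStore ''acc'' (IVar ''a'')
         (RMul (RArr ''w'' (IArr ''ord'' (IVar ''a''))) (RArr ''d'' (IVar ''a'')))))"

definition distances :: com where
  "distances = loop ''a'' ''n'' distances_body"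

text \<open>While no candidate is stored, the first conjunct is false, so the arbitrary content of
  \<open>C\<close> at that index has no effect. On ties the earlier candidate stays.\<close>

definition improve :: "string \<Rightarrow> string \<Rightarrow> com" where
  "improve M C = Cond (BAnd (ILess (IConst 0) (IArr M (IVar ''k'')))
       (BNot (RLess (RVar ''cost'') (RArr C (IVar ''k'')))))
     Skip
     (Seq (IStore M (IVar ''k'') (IArr ''ord'' (IVar ''x''))) (RStore C (IVar ''k'') (RVar ''cost'')))"

definition improve_all_body :: com where
  "improve_all_body =
     (Cond (ILess (IConst 1) (IVar ''a''))
       (Seq (ISet ''k'' (IArr ''ei'' (IVar ''a'')))
         (Cond (RLess (RConst 0) (RArr ''mk'' (IVar ''a'')))
           (Seq (RSet ''cost'' (RArr ''acc'' (IVar ''a''))) (improve ''m1'' ''c1''))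
           (Seq (RSet ''cost'' (RSub (RArr ''acc'' (IConst 1)) (RArr ''acc'' (IVar ''a''))))
             (improve ''m2'' ''c2''))))
       Skip)"

definition improve_all :: com where
  "improve_all = loop ''a'' ''n'' improve_all_body"

definition scan :: com where
  "scan = Seq fill_mark (Seq (accumulate ''mk'') (Seq distances (Seq (accumulate ''acc'') improve_all)))"

text \<open>\<open>m1\<close> and \<open>m2\<close> are indexed by input edges, not by positions;
  clearing the cells up to \<open>n\<close> covers them since there are \<open>n - 1\<close>
  edges.\<close>

definition preprocess :: com where
  "preprocess = loop ''a'' ''n''
     (Seq (Cond (ILess (IConst 1) (IVar ''a''))
         (RStore ''dep'' (IVar ''a'') (RAdd (RArr ''dep'' (IArr ''pp'' (IVar ''a'')))
           (RArr ''len'' (IArr ''ei'' (IVar ''a'')))))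
         (RStore ''dep'' (IVar ''a'') (RConst 0)))
       (Seq (RStore ''zs'' (IVar ''a'') (RMul (RArr ''w'' (IArr ''ord'' (IVar ''a'')))
           (RArr ''t'' (IArr ''ord'' (IVar ''a'')))))
       (Seq (IStore ''m1'' (IVar ''a'') (IConst 0)) (IStore ''m2'' (IVar ''a'') (IConst 0)))))"

definition evaluate_body :: com where
  "evaluate_body = Cond (ILess (IConst 1) (IVar ''a''))
     (Seq (ISet ''k'' (IArr ''ei'' (IVar ''a'')))
     (Seq (RSet ''dz'' (RSub (RArr ''zs'' (IVar ''a''))
         (RSub (RArr ''zs'' (IConst 1)) (RArr ''zs'' (IVar ''a'')))))
     (Seq (Cond (RLess (RVar ''dz'') (RConst 0)) (RSet ''dz'' (RSub (RConst 0) (RVar ''dz''))) Skip)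
     (Seq (RStore ''f'' (IVar ''k'') (RAdd
         (RMul (RVar ''lambda'') (RAdd (RArr ''c1'' (IVar ''k'')) (RArr ''c2'' (IVar ''k''))))
         (RMul (RSub (RConst 1) (RVar ''lambda'')) (RVar ''dz''))))
       (Cond (BAnd (ILess (IConst 0) (IVar ''best''))
           (BNot (RLess (RArr ''f'' (IVar ''k'')) (RArr ''f'' (IVar ''best'')))))
         Skip (ISet ''best'' (IVar ''k'')))))))
     Skip"

definition evaluate :: com where
  "evaluate = loop ''a'' ''n'' evaluate_body"

definition search_body :: com where
  "search_body =
     Seq (ISet ''a'' (IArr ''u'' (IVar ''k'')))
     (Seq (ISet ''b'' (IArr ''v'' (IVar ''k'')))
     (Seq (Cond (ILess (IConst 0) (IArr ''pos'' (IVar ''a''))) Skip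
       (Seq (ISet ''a'' (IArr ''v'' (IVar ''k''))) (ISet ''b'' (IArr ''u'' (IVar ''k'')))))
     (Cond (BAnd (ILess (IConst 0) (IArr ''pos'' (IVar ''a'')))
         (BNot (ILess (IConst 0) (IArr ''pos'' (IVar ''b'')))))
       (Seq (ISet ''c'' (IAdd (IVar ''c'') (IConst 1)))
       (Seq (IStore ''ord'' (IVar ''c'') (IVar ''b''))
       (Seq (IStore ''pos'' (IVar ''b'') (IVar ''c''))
       (Seq (IStore ''pp'' (IVar ''c'') (IArr ''pos'' (IVar ''a'')))
         (IStore ''ei'' (IVar ''c'') (IVar ''k''))))))
       Skip)))"

definition clear_pos :: com where
  "clear_pos = loop ''i'' ''n'' (IStore ''pos'' (IVar ''i'') (IConst 0))"

definition place_root :: com where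
  "place_root = Seq (IStore ''ord'' (IConst 1) (IConst 1))
     (Seq (IStore ''pos'' (IConst 1) (IConst 1)) (ISet ''c'' (IConst 1)))"

definition search :: com where
  "search = Seq clear_pos (Seq place_root (loop ''r'' ''n'' (loop ''k'' ''m'' search_body)))"

definition edge_deletion :: com where
  "edge_deletion =
     Seq search (Seq preprocess (Seq (accumulate ''zs'') (Seq (loop ''x'' ''n'' scan)
     (Seq (ISet ''best'' (IConst 0)) (Seq evaluate
     (Seq (ISet ''x1'' (IArr ''m1'' (IVar ''best''))) (ISet ''x2'' (IArr ''m2'' (IVar ''best'')))))))))"

section \<open>Correctness of the parts\<close>

context parents
begin

lemma proj_pred:
  assumes "2 \<le> q" "q \<le> n"
  shows "proj p (q - 1) i = (if proj p q i = q then p q else proj p q i)"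
  using assms proj_Suc[of p "q - 1" i] min_parent[of q] by simp

text \<open>The positions projecting to \<open>c\<close> stay the same when the cutoff drops below
  \<open>q\<close>, except that the parent of \<open>q\<close> inherits all positions that had
  stopped at \<open>q\<close>, and these form the subtree of \<open>q\<close>.\<close>

lemma sum_proj_pred:
  fixes g :: "nat \<Rightarrow> real"
  assumes "2 \<le> q" "q \<le> n" "c < q"
  shows "(\<Sum>j\<in>{j\<in>{1..n}. proj p (q - 1) j = c}. g j) =
    (\<Sum>j\<in>{j\<in>{1..n}. proj p q j = c}. g j) + (if c = p q then \<Sum>j\<in>subtree p n q. g j else 0)"
proof (cases "c = p q")
  case True
  have "{j\<in>{1..n}. proj p (q - 1) j = c} = {j\<in>{1..n}. proj p q j = c} \<union> subtree p n q"
    using assms True by (auto simp: proj_pred[unfolded One_nat_def] subtree_def)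
  moreover have "{j\<in>{1..n}. proj p q j = c} \<inter> subtree p n q = {}"
    using assms by (auto simp: subtree_def)
  ultimately show ?thesis
    using True by (simp add: sum.union_disjoint subtree_def)
next
  case False
  then have "{j\<in>{1..n}. proj p (q - 1) j = c} = {j\<in>{1..n}. proj p q j = c}"
    using assms by (auto simp: proj_pred[unfolded One_nat_def])
  then show ?thesis using False by simp
qed

end

lemma runs_accumulate:
  assumes par: "parents n (iarr s ''pp'')" and n: "n = ivar s ''n''" and k: "28 * n + 7 \<le> k"
  shows "runs (accumulate A) s k
    (\<lambda>s'. \<forall>c\<in>{1..n}. rarr s' A c = (\<Sum>i\<in>subtree (iarr s ''pp'') n c. rarr s A i))"
proof -
  interpret parents n "iarr s ''pp''" by (fact par)
  let ?p = "iarr s ''pp''" and ?g = "rarr s A"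
  \<comment> \<open>The cutoff is \<open>n - i\<close>: entries up to it hold the sum over all
    positions projecting to them, entries beyond it are final. At cutoff \<open>n\<close> every
    position projects to itself, and at cutoff 0 all entries are final.\<close>
  define I where "I i s' \<longleftrightarrow> (\<forall>c\<in>{1..n}. rarr s' A c =
      (if c \<le> n - i then \<Sum>j\<in>{j\<in>{1..n}. proj ?p (n - i) j = c}. ?g j else \<Sum>j\<in>subtree ?p n c. ?g j))"
    for i and s' :: state
  show ?thesis
    unfolding accumulate_def
  proof (rule runs_loop[where I = I and k = 19])
    show "I 0 s"
      by (auto simp: I_def proj_le Collect_conv_if cong: conj_cong)
  next
    fix i s' assume i: "i < ivar s ''n''" and I: "I i s'"
      and fr: "frame (loop ''i'' ''n'' (accumulate_body A)) s s'" and cnt: "ivar s' ''i'' = Suc i"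
    define q where "q = n - i"
    have q: "1 \<le> q" "q \<le> n" "n - Suc i = q - 1" using i n by (auto simp: q_def)
    have st: "ivar s' ''n'' = n" "iarr s' ''pp'' = ?p"
      using frameD[OF fr] n by (simp_all add: accumulate_body_def)
    have A: "rarr s' A c = (if c \<le> q then \<Sum>j\<in>{j\<in>{1..n}. proj ?p q j = c}. ?g j
        else \<Sum>j\<in>subtree ?p n c. ?g j)" if "c \<in> {1..n}" for c
      using I that by (simp add: I_def q_def)
    have "I (Suc i) (run (accumulate_body A) s')"
      unfolding I_def
    proof
      fix c assume c: "c \<in> {1..n}"
      have a: "Suc n - Suc i = q" using q_def by simp
      show "rarr (run (accumulate_body A) s') A c =
        (if c \<le> n - Suc i then \<Sum>j\<in>{j\<in>{1..n}. proj ?p (n - Suc i) j = c}. ?g j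
         else \<Sum>j\<in>subtree ?p n c. ?g j)"
      proof (cases "q = 1")
        \<comment> \<open>The root has no parent, so the body writes nothing to \<open>A\<close>;
          the positions projecting to 1 at cutoff 1 are already its whole subtree.\<close>
        case True
        then show ?thesis
          using c A[OF c] q st cnt a by (auto simp: accumulate_body_def subtree_def)
      next
        case False
        then have q2: "2 \<le> q" using q by simp
        then have pq: "1 \<le> ?p q" "?p q < q" using parent[of q] q by auto
        have Aq: "rarr s' A q = (\<Sum>j\<in>subtree ?p n q. ?g j)"
          using A[of q] q by (simp add: subtree_def)
        have "rarr (run (accumulate_body A) s') A c =
            rarr s' A c + (if c = ?p q then rarr s' A q else 0)"
          using q2 st cnt a by (simp add: accumulate_body_def)
        then show ?thesis
          using A[OF c] Aq q q2 c pq sum_proj_pred[OF q2 q(2), of c ?g]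
          by (cases "c = q"; cases "c < q") (auto simp: subtree_def)
      qed
    qed
    then show "runs (accumulate_body A) s' 19 (I (Suc i))"
      by (rule runs_run[rotated]) (simp_all add: accumulate_body_def)
  qed (use k n in \<open>auto simp: accumulate_body_def I_def\<close>)
qed

section \<open>Marks and distances for a fixed facility\<close>

lemma runs_fill_mark:
  assumes n: "n = ivar s ''n''" and k: "22 * n + 7 \<le> k"
  shows "runs fill_mark s k
    (\<lambda>s'. \<forall>c\<in>{1..n}. rarr s' ''mk'' c = (if c = ivar s ''x'' then 1 else 0))"
  unfolding fill_mark_def
proof (rule runs_loop[where k = 13 and
      I = "\<lambda>i s'. \<forall>c\<in>{1..i}. rarr s' ''mk'' c = (if c = ivar s ''x'' then 1 else 0)"], goal_cases)
  \<comment> \<open>In this and all later uses of \<open>runs_loop\<close>, goal 6 is one round of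
    the loop (\<open>step\<close>) and goal 7 the exit (\<open>post\<close>).\<close>
  case (6 i s')
  then have "ivar s' ''x'' = ivar s ''x''" by (auto dest!: frameD(1)[of _ _ _ "''x''"])
  with 6 show ?case by (intro runs_run) auto
qed (use k n in auto)

lemma runs_distances:
  fixes s :: state
  defines "p \<equiv> iarr s ''pp''" and "x \<equiv> ivar s ''x''"
    and "l \<equiv> \<lambda>j. rarr s ''len'' (iarr s ''ei'' j)"
  assumes par: "parents n p" and n: "n = ivar s ''n''" and x: "x \<in> {1..n}"
    and mark: "\<forall>c\<in>{1..n}. rarr s ''mk'' c = (if x \<in> subtree p n c then 1 else 0)"
    and dep: "rarr s ''dep'' x = tdist p l 1 x" and k: "35 * n + 7 \<le> k"
  shows "runs distances s k
    (\<lambda>s'. \<forall>c\<in>{1..n}. rarr s' ''acc'' c = rarr s ''w'' (iarr s ''ord'' c) * tdist p l x c)"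
proof -
  interpret parents n p by (fact par)
  define I where "I i s' \<longleftrightarrow> (\<forall>c\<in>{1..i}. rarr s' ''d'' c = tdist p l x c \<and>
      rarr s' ''acc'' c = rarr s ''w'' (iarr s ''ord'' c) * tdist p l x c)" for i and s' :: state
  show ?thesis
    unfolding distances_def
  proof (rule runs_loop[where I = I and k = 26], goal_cases)
    case (6 i s')
    note fr = frameD[OF 6(3)]
    have st: "ivar s' ''x'' = x" "iarr s' ''pp'' = p" "iarr s' ''ei'' = iarr s ''ei''"
      "iarr s' ''ord'' = iarr s ''ord''" "rarr s' ''len'' = rarr s ''len''"
      "rarr s' ''mk'' = rarr s ''mk''" "rarr s' ''dep'' = rarr s ''dep''" "rarr s' ''w'' = rarr s ''w''"
      using fr by (simp_all add: p_def x_def distances_body_def)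
    have i: "Suc i \<in> {1..n}" using 6(1) n by simp
    show ?case
    proof (rule runs_run)
      show "I (Suc i) (run distances_body s')"
      proof (cases "i = 0")
        \<comment> \<open>The pass starts at the root, whose distance from \<open>x\<close> is the
          depth of \<open>x\<close> by symmetry; all other positions follow by
          \<open>tdist_edge\<close>.\<close>
        case True
        then show ?thesis
          using st 6(4) dep tdist_commute[of p l 1 x] by (simp add: I_def distances_body_def)
      next
        case False
        then have a: "2 \<le> Suc i" "Suc i \<le> n" using i by auto
        then have pa: "1 \<le> p (Suc i)" "p (Suc i) < Suc i" using parent[of "Suc i"] by auto
        have d: "rarr s' ''d'' (p (Suc i)) = tdist p l x (p (Suc i))"
          using 6(2) pa by (simp add: I_def)
        have m: "rarr s ''mk'' (Suc i) = (if x \<in> subtree p n (Suc i) then 1 else 0)"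
          using mark i by blast
        have I: "c \<in> {1..i} \<Longrightarrow> rarr s' ''d'' c = tdist p l x c \<and>
          rarr s' ''acc'' c = rarr s ''w'' (iarr s ''ord'' c) * tdist p l x c" for c
          using 6(2) by (simp add: I_def)
        have l: "rarr s ''len'' (iarr s ''ei'' (Suc i)) = l (Suc i)" by (simp add: l_def)
        show ?thesis
          using tdist_edge[OF a, of x l] x I False
          by (auto simp: I_def distances_body_def st 6(4) d m l le_Suc_eq)
      qed
    qed (simp_all add: distances_body_def)
  qed (use k n in \<open>auto simp: I_def distances_body_def\<close>)
qed

section \<open>Best facilities among the candidates offered so far\<close>

text \<open>\<open>M = 0\<close> marks that no candidate has been seen yet.\<close>

definition is_min :: "(nat \<Rightarrow> nat) \<Rightarrow> nat set \<Rightarrow> (nat \<Rightarrow> real) \<Rightarrow> nat \<Rightarrow> real \<Rightarrow> bool" where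
  "is_min ord S f M C \<longleftrightarrow>
     (if S = {} then M = 0 else \<exists>y\<in>S. M = ord y \<and> C = f y \<and> (\<forall>y'\<in>S. f y \<le> f y'))"

text \<open>The conditionals mirror \<open>improve\<close>. Positivity of \<open>ord\<close> on
  \<open>S\<close> makes \<open>0 < M\<close> equivalent to \<open>S\<close> being nonempty.\<close>

lemma is_min_insert:
  assumes "is_min ord S f M C" "\<forall>y\<in>S. 0 < ord y"
  shows "is_min ord (insert x S) f (if 0 < M \<and> \<not> f x < C then M else ord x)
    (if 0 < M \<and> \<not> f x < C then C else f x)"
  using assms by (fastforce simp: is_min_def split: if_splits)

definition side_cost :: "(nat \<Rightarrow> nat) \<Rightarrow> (nat \<Rightarrow> nat) \<Rightarrow> (nat \<Rightarrow> real) \<Rightarrow> (nat \<Rightarrow> real) \<Rightarrow> nat set \<Rightarrow> nat \<Rightarrow> real"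
  where "side_cost p ord w l S y = (\<Sum>i\<in>S. w (ord i) * tdist p l y i)"

text \<open>The bound \<open>X\<close> restricts the candidates only; costs are always those of
  serving the whole side. \<open>X = 0\<close> is the cleared state, and \<open>X = n\<close> yields
  1-medians of both sides.\<close>

definition sides_min :: "nat \<Rightarrow> (nat \<Rightarrow> nat) \<Rightarrow> (nat \<Rightarrow> nat) \<Rightarrow> (nat \<Rightarrow> nat) \<Rightarrow> (nat \<Rightarrow> real) \<Rightarrow>
    (nat \<Rightarrow> real) \<Rightarrow> state \<Rightarrow> nat \<Rightarrow> nat \<Rightarrow> bool" where
  "sides_min n p ord ei w l s j X \<longleftrightarrow>
     is_min ord ({1..X} \<inter> subtree p n j) (side_cost p ord w l (subtree p n j))
       (iarr s ''m1'' (ei j)) (rarr s ''c1'' (ei j)) \<and>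
     is_min ord ({1..X} - subtree p n j) (side_cost p ord w l ({1..n} - subtree p n j))
       (iarr s ''m2'' (ei j)) (rarr s ''c2'' (ei j))"

lemma runs_improve_all:
  fixes s :: state
  defines "p \<equiv> iarr s ''pp''" and "x \<equiv> ivar s ''x''" and "ord \<equiv> iarr s ''ord''"
    and "ei \<equiv> iarr s ''ei''"
  assumes par: "parents n p" and n: "n = ivar s ''n''" and x: "x \<in> {1..n}"
    and ord: "\<forall>j\<in>{1..n}. 0 < ord j" and ei: "inj_on ei {2..n}"
    and mark: "\<forall>c\<in>{1..n}. rarr s ''mk'' c = (if x \<in> subtree p n c then 1 else 0)"
    and acc: "\<forall>c\<in>{1..n}. rarr s ''acc'' c = side_cost p ord w l (subtree p n c) x"
    and mins: "\<forall>j\<in>{2..n}. sides_min n p ord ei w l s j (x - 1)" and k: "50 * n + 7 \<le> k"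
  shows "runs improve_all s k (\<lambda>s'. \<forall>j\<in>{2..n}. sides_min n p ord ei w l s' j x)"
proof -
  interpret parents n p by (fact par)
  \<comment> \<open>Within the pass for \<open>x\<close>, edges above positions up to
    \<open>i\<close> have already been offered \<open>x\<close>, the others only the candidates
    before it.\<close>
  define I where "I i s' \<longleftrightarrow>
      (\<forall>j\<in>{2..n}. sides_min n p ord ei w l s' j (if j \<le> i then x else x - 1))"
    for i and s' :: state
  show ?thesis
    unfolding improve_all_def
  proof (rule runs_loop[where I = I and k = 41], goal_cases)
    case (6 i s')
    note fr = frameD[OF 6(3)]
    have st: "ivar s' ''x'' = x" "iarr s' ''ei'' = ei" "iarr s' ''ord'' = ord"
      "rarr s' ''mk'' = rarr s ''mk''" "rarr s' ''acc'' = rarr s ''acc''"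
      using fr by (simp_all add: x_def ei_def ord_def improve_all_body_def improve_def)
    have i: "Suc i \<in> {1..n}" using 6(1) n by simp
    show ?case
    proof (rule runs_run)
      let ?s = "run improve_all_body s'"
      show "I (Suc i) ?s"
      proof (cases "i = 0")
        case True
        then show ?thesis
          using 6(2,4) by (auto simp: I_def improve_all_body_def)
      next
        case False
        let ?a = "Suc i" and ?k = "ei (Suc i)"
        have a: "?a \<in> {2..n}" using False i by auto
        have m: "rarr s ''mk'' ?a = (if x \<in> subtree p n ?a then 1 else 0)"
          using mark i by blast
        have c1: "rarr s ''acc'' ?a = side_cost p ord w l (subtree p n ?a) x"
          using acc i by blast
        have "rarr s ''acc'' 1 = side_cost p ord w l {1..n} x"
          using acc i subtree_root by auto
        then have c2: "rarr s ''acc'' 1 - rarr s ''acc'' ?a =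
            side_cost p ord w l ({1..n} - subtree p n ?a) x"
          using c1 sum_diff[OF finite_atLeastAtMost subtree_subset, of "\<lambda>i. w (ord i) * tdist p l x i" ?a]
          by (simp add: side_cost_def)
        have old: "sides_min n p ord ei w l s' ?a (x - 1)"
          using bspec[OF 6(2)[unfolded I_def] a] by simp
        have x1: "{1..x} = insert x {1..x - 1}" using x by auto
        have new: "sides_min n p ord ei w l ?s ?a x"
        proof (cases "x \<in> subtree p n ?a")
          case True
          have "{1..x} \<inter> subtree p n ?a = insert x ({1..x - 1} \<inter> subtree p n ?a)"
            "{1..x} - subtree p n ?a = {1..x - 1} - subtree p n ?a"
            unfolding x1 using True by auto
          moreover have "\<forall>y\<in>{1..x - 1} \<inter> subtree p n ?a. 0 < ord y" using ord x by auto
          ultimately show ?thesis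
            using old is_min_insert[of ord "{1..x - 1} \<inter> subtree p n ?a"
                "side_cost p ord w l (subtree p n ?a)" "iarr s' ''m1'' ?k" "rarr s' ''c1'' ?k" x]
            by (auto simp: sides_min_def st 6(4) False improve_all_body_def improve_def m True c1 simp del: One_nat_def)
        next
          case nin: False
          have "{1..x} \<inter> subtree p n ?a = {1..x - 1} \<inter> subtree p n ?a"
            "{1..x} - subtree p n ?a = insert x ({1..x - 1} - subtree p n ?a)"
            unfolding x1 using nin by auto
          moreover have "\<forall>y\<in>{1..x - 1} - subtree p n ?a. 0 < ord y" using ord x by auto
          ultimately show ?thesis
            using old is_min_insert[of ord "{1..x - 1} - subtree p n ?a"
                "side_cost p ord w l ({1..n} - subtree p n ?a)" "iarr s' ''m2'' ?k" "rarr s' ''c2'' ?k" x]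
            by (auto simp: sides_min_def st 6(4) False improve_all_body_def improve_def m nin c2 simp del: One_nat_def)
        qed
        have other: "sides_min n p ord ei w l ?s j X = sides_min n p ord ei w l s' j X"
          if "j \<in> {2..n}" "j \<noteq> ?a" for j X
        proof -
          \<comment> \<open>Results are stored per input edge, so injectivity of \<open>ei\<close>
            keeps the update for one edge from touching another.\<close>
          have "ei j \<noteq> ?k" using inj_onD[OF ei, of j ?a] that a by blast
          then show ?thesis
            by (simp add: sides_min_def st 6(4) improve_all_body_def improve_def)
        qed
        show ?thesis
          unfolding I_def
        proof
          fix j assume j: "j \<in> {2..n}"
          show "sides_min n p ord ei w l ?s j (if j \<le> Suc i then x else x - 1)"
            using new other[OF j] 6(2) j by (cases "j = ?a") (auto simp: I_def le_Suc_eq)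
        qed
      qed
    qed (simp_all add: improve_all_body_def improve_def)
  next
    case (7 s')
    then show ?case using n by (auto simp: I_def)
  qed (use k n mins in \<open>auto simp: I_def improve_all_body_def improve_def sides_min_def\<close>)
qed

lemma program_mods [simp]:
  "ivars_mod (accumulate A) = {''i'', ''a''}" "iarrs_mod (accumulate A) = {}"
  "rvars_mod (accumulate A) = {}" "rarrs_mod (accumulate A) = {A}"
  "ivars_mod fill_mark = {''i''}" "iarrs_mod fill_mark = {}"
  "rvars_mod fill_mark = {}" "rarrs_mod fill_mark = {''mk''}"
  "ivars_mod distances = {''a''}" "iarrs_mod distances = {}"
  "rvars_mod distances = {}" "rarrs_mod distances = {''d'', ''acc''}"
  "ivars_mod improve_all = {''a'', ''k''}" "iarrs_mod improve_all = {''m1'', ''m2''}"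
  "rvars_mod improve_all = {''cost''}" "rarrs_mod improve_all = {''c1'', ''c2''}"
  "ivars_mod preprocess = {''a''}" "iarrs_mod preprocess = {''m1'', ''m2''}"
  "rvars_mod preprocess = {}" "rarrs_mod preprocess = {''dep'', ''zs''}"
  "ivars_mod evaluate = {''a'', ''k'', ''best''}" "iarrs_mod evaluate = {}"
  "rvars_mod evaluate = {''dz''}" "rarrs_mod evaluate = {''f''}"
  "ivars_mod search = {''i'', ''c'', ''r'', ''k'', ''a'', ''b''}"
  "iarrs_mod search = {''pos'', ''ord'', ''pp'', ''ei''}" "rvars_mod search = {}" "rarrs_mod search = {}"
  by (auto simp: accumulate_def accumulate_body_def fill_mark_def distances_def distances_body_def
      improve_all_def improve_all_body_def
      improve_def preprocess_def evaluate_def evaluate_body_def search_def clear_pos_def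
      place_root_def search_body_def)

lemma scan_mods [simp]:
  "ivars_mod scan = {''i'', ''a'', ''k''}" "iarrs_mod scan = {''m1'', ''m2''}"
  "rvars_mod scan = {''cost''}" "rarrs_mod scan = {''mk'', ''d'', ''acc'', ''c1'', ''c2''}"
  by (auto simp: scan_def)

lemma sides_min_cong:
  assumes "iarr s' ''m1'' = iarr s ''m1''" "iarr s' ''m2'' = iarr s ''m2''"
    "rarr s' ''c1'' = rarr s ''c1''" "rarr s' ''c2'' = rarr s ''c2''"
  shows "sides_min n p ord ei w l s' j X = sides_min n p ord ei w l s j X"
  using assms by (simp add: sides_min_def)

text \<open>The bound adds up the five passes: 163 = 22 + 28 + 35 + 28 + 50, and 35 is five times
  the fixed overhead 7 of a loop.\<close>

lemma runs_scan:
  fixes s :: state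
  defines "p \<equiv> iarr s ''pp''" and "x \<equiv> ivar s ''x''" and "ord \<equiv> iarr s ''ord''"
    and "ei \<equiv> iarr s ''ei''" and "w \<equiv> rarr s ''w''"
    and "l \<equiv> \<lambda>j. rarr s ''len'' (iarr s ''ei'' j)"
  assumes par: "parents n p" and n: "n = ivar s ''n''" and x: "x \<in> {1..n}"
    and ord: "\<forall>j\<in>{1..n}. 0 < ord j" and ei: "inj_on ei {2..n}"
    and dep: "rarr s ''dep'' x = tdist p l 1 x"
    and mins: "\<forall>j\<in>{2..n}. sides_min n p ord ei w l s j (x - 1)" and k: "163 * n + 35 \<le> k"
  shows "runs scan s k (\<lambda>s'. \<forall>j\<in>{2..n}. sides_min n p ord ei w l s' j x)"
  unfolding scan_def
proof (rule runs_Seq[OF runs_fill_mark[OF n order_refl]])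
  fix s1 assume mk1: "\<forall>c\<in>{1..n}. rarr s1 ''mk'' c = (if c = ivar s ''x'' then 1 else 0)"
    and fr1: "frame fill_mark s s1"
  note fr1 = frameD[OF fr1]
  have n1: "n = ivar s1 ''n''" and p1: "iarr s1 ''pp'' = p"
    using fr1 n by (simp_all add: p_def)
  show "runs (Seq (accumulate ''mk'') (Seq distances (Seq (accumulate ''acc'') improve_all))) s1
    (141 * n + 28) (\<lambda>s'. \<forall>j\<in>{2..n}. sides_min n p ord ei w l s' j x)"
  proof (rule runs_Seq[OF runs_accumulate[OF _ n1 order_refl]])
    show "parents n (iarr s1 ''pp'')" using par p1 by simp
    fix s2 assume mk2: "\<forall>c\<in>{1..n}. rarr s2 ''mk'' c =
        (\<Sum>i\<in>subtree (iarr s1 ''pp'') n c. rarr s1 ''mk'' i)" and fr2: "frame (accumulate ''mk'') s1 s2"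
    note fr2 = frameD[OF fr2]
    have st2: "n = ivar s2 ''n''" "iarr s2 ''pp'' = p" "ivar s2 ''x'' = x" "iarr s2 ''ei'' = ei"
      "iarr s2 ''ord'' = ord" "rarr s2 ''len'' = rarr s ''len''" "rarr s2 ''w'' = w"
      "rarr s2 ''dep'' = rarr s ''dep''"
      using fr1 fr2 n by (simp_all add: p_def x_def ei_def ord_def w_def)
    have mark: "rarr s2 ''mk'' c = (if x \<in> subtree p n c then 1 else 0)" if "c \<in> {1..n}" for c
    proof -
      have "rarr s2 ''mk'' c = (\<Sum>i\<in>subtree p n c. if i = x then 1 else 0)"
        using mk2 that p1 mk1 by (auto simp: subtree_def x_def intro!: sum.cong)
      then show ?thesis by (simp add: sum.delta subtree_def)
    qed
    show "runs (Seq distances (Seq (accumulate ''acc'') improve_all)) s2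
      (113 * n + 21) (\<lambda>s'. \<forall>j\<in>{2..n}. sides_min n p ord ei w l s' j x)"
    proof (rule runs_Seq[OF runs_distances[OF _ st2(1) _ _ _ order_refl],
        where ?k2.0 = "78 * n + 14"], goal_cases)
      case (5 s3)
      note fr3 = frameD[OF 5(2)]
      have st3: "n = ivar s3 ''n''" "iarr s3 ''pp'' = p" "ivar s3 ''x'' = x" "iarr s3 ''ei'' = ei"
        "iarr s3 ''ord'' = ord" "rarr s3 ''mk'' = rarr s2 ''mk''"
        using fr3 st2 by simp_all
      have acc3: "\<forall>c\<in>{1..n}. rarr s3 ''acc'' c = w (ord c) * tdist p l x c"
        using 5(1) st2 by (simp add: l_def ei_def)
      show ?case
      proof (rule runs_Seq[OF runs_accumulate[OF _ st3(1) order_refl],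
          where ?k2.0 = "50 * n + 7"], goal_cases)
        case (2 s4)
        note fr4 = frameD[OF 2(2)]
        have st4: "n = ivar s4 ''n''" "iarr s4 ''pp'' = p" "ivar s4 ''x'' = x" "iarr s4 ''ei'' = ei"
          "iarr s4 ''ord'' = ord" "rarr s4 ''mk'' = rarr s2 ''mk''"
          using fr4 st3 by simp_all
        have arrs: "iarr s4 ''m1'' = iarr s ''m1''" "iarr s4 ''m2'' = iarr s ''m2''"
          "rarr s4 ''c1'' = rarr s ''c1''" "rarr s4 ''c2'' = rarr s ''c2''"
          using fr1 fr2 fr3 fr4 by simp_all
        have acc4: "\<forall>c\<in>{1..n}. rarr s4 ''acc'' c = side_cost p ord w l (subtree p n c) x"
          using 2(1) acc3 st3(2) by (auto simp: side_cost_def subtree_def intro!: sum.cong)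
        have "runs improve_all s4 (50 * n + 7) (\<lambda>s'. \<forall>j\<in>{2..n}.
            sides_min n (iarr s4 ''pp'') (iarr s4 ''ord'') (iarr s4 ''ei'') w l s' j (ivar s4 ''x''))"
          by (rule runs_improve_all)
            (use par st4 x ord ei mark acc4 mins sides_min_cong[OF arrs] in simp_all)
        then show ?case by (simp add: st4)
      next
        case 3
        show ?case by simp
      qed (use par st3 in simp)
    qed (use par st2 x mark dep in \<open>simp_all add: l_def ei_def\<close>)
  qed simp
qed (use k in simp)

lemma runs_scan_all:
  fixes s :: state
  defines "p \<equiv> iarr s ''pp''" and "ord \<equiv> iarr s ''ord''"
    and "ei \<equiv> iarr s ''ei''" and "w \<equiv> rarr s ''w''"
    and "l \<equiv> \<lambda>j. rarr s ''len'' (iarr s ''ei'' j)"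
  assumes par: "parents n p" and n: "n = ivar s ''n''"
    and ord: "\<forall>j\<in>{1..n}. 0 < ord j" and ei: "inj_on ei {2..n}"
    and dep: "\<forall>x\<in>{1..n}. rarr s ''dep'' x = tdist p l 1 x"
    and mins: "\<forall>j\<in>{2..n}. sides_min n p ord ei w l s j 0" and k: "n * (163 * n + 44) + 7 \<le> k"
  shows "runs (loop ''x'' ''n'' scan) s k (\<lambda>s'. \<forall>j\<in>{2..n}. sides_min n p ord ei w l s' j n)"
proof (rule runs_loop[where k = "163 * n + 35" and
      I = "\<lambda>i s'. \<forall>j\<in>{2..n}. sides_min n p ord ei w l s' j i"], goal_cases)
  case (6 i s')
  note fr = frameD[OF 6(3)]
  have st: "ivar s' ''n'' = n" "iarr s' ''pp'' = p" "iarr s' ''ei'' = ei"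
    "iarr s' ''ord'' = ord" "rarr s' ''len'' = rarr s ''len''" "rarr s' ''w'' = w"
    "rarr s' ''dep'' = rarr s ''dep''"
    using fr n by (simp_all add: p_def ei_def ord_def w_def)
  have l: "(\<lambda>j. rarr s ''len'' (ei j)) = l" by (simp add: l_def ei_def)
  have "runs scan s' (163 * n + 35) (\<lambda>s''. \<forall>j\<in>{2..n}. sides_min n (iarr s' ''pp'') (iarr s' ''ord'')
      (iarr s' ''ei'') (rarr s' ''w'') (\<lambda>j. rarr s' ''len'' (iarr s' ''ei'' j)) s'' j (ivar s' ''x''))"
    by (rule runs_scan) (use 6 par n ord ei dep st l in simp_all)
  then show ?case by (simp add: st l 6(4))
qed (use k n mins in \<open>auto simp: sides_min_def algebra_simps\<close>)

section \<open>Precomputation and choice of the best edge\<close>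

lemma runs_preprocess:
  fixes s :: state
  defines "p \<equiv> iarr s ''pp''" and "ord \<equiv> iarr s ''ord''"
    and "l \<equiv> \<lambda>j. rarr s ''len'' (iarr s ''ei'' j)"
  assumes par: "parents n p" and n: "n = ivar s ''n''" and k: "37 * n + 7 \<le> k"
  shows "runs preprocess s k (\<lambda>s'. \<forall>c\<in>{1..n}. rarr s' ''dep'' c = tdist p l 1 c \<and>
    rarr s' ''zs'' c = rarr s ''w'' (ord c) * rarr s ''t'' (ord c) \<and>
    iarr s' ''m1'' c = 0 \<and> iarr s' ''m2'' c = 0)"
proof -
  interpret parents n p by (fact par)
  define I where "I i s' \<longleftrightarrow> (\<forall>c\<in>{1..i}. rarr s' ''dep'' c = tdist p l 1 c \<and>
    rarr s' ''zs'' c = rarr s ''w'' (ord c) * rarr s ''t'' (ord c) \<and>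
    iarr s' ''m1'' c = 0 \<and> iarr s' ''m2'' c = 0)" for i and s' :: state
  show ?thesis
    unfolding preprocess_def
  proof (rule runs_loop[where I = I and k = 28], goal_cases)
    case (6 i s')
    note fr = frameD[OF 6(3)]
    have st: "iarr s' ''pp'' = p" "iarr s' ''ei'' = iarr s ''ei''"
      "iarr s' ''ord'' = ord" "rarr s' ''len'' = rarr s ''len''"
      "rarr s' ''w'' = rarr s ''w''" "rarr s' ''t'' = rarr s ''t''"
      using fr by (simp_all add: p_def ord_def)
    have I: "c \<in> {1..i} \<Longrightarrow> rarr s' ''dep'' c = tdist p l 1 c \<and>
        rarr s' ''zs'' c = rarr s ''w'' (ord c) * rarr s ''t'' (ord c) \<and>
        iarr s' ''m1'' c = 0 \<and> iarr s' ''m2'' c = 0" for c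
      using 6(2) by (simp add: I_def)
    have l: "rarr s ''len'' (iarr s ''ei'' (Suc i)) = l (Suc i)" by (simp add: l_def)
    have pa: "i \<noteq> 0 \<Longrightarrow> p (Suc i) \<in> {1..i} \<and> tdist p l 1 (Suc i) = tdist p l 1 (p (Suc i)) + l (Suc i)"
      using parent[of "Suc i"] 6(1) n tdist_parent1[of 1 "Suc i" l] by simp
    show ?case
      by (rule runs_run; cases "i = 0")
        (use I pa in \<open>auto simp: I_def st 6(4) l le_Suc_eq\<close>)
  qed (use k n in \<open>auto simp: I_def\<close>)
qed

lemma runs_evaluate:
  fixes s :: state
  defines "ei \<equiv> iarr s ''ei''"
    and "fv \<equiv> \<lambda>j. rvar s ''lambda'' * (rarr s ''c1'' (iarr s ''ei'' j) + rarr s ''c2'' (iarr s ''ei'' j)) +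
      (1 - rvar s ''lambda'') * \<bar>rarr s ''zs'' j - (rarr s ''zs'' 1 - rarr s ''zs'' j)\<bar>"
  assumes n: "n = ivar s ''n''" "2 \<le> n" and ei: "inj_on ei {2..n}" "\<forall>j\<in>{2..n}. 0 < ei j"
    and best: "ivar s ''best'' = 0" and k: "70 * n + 7 \<le> k"
  shows "runs evaluate s k (\<lambda>s'. (\<forall>j\<in>{2..n}. rarr s' ''f'' (ei j) = fv j) \<and>
    (\<exists>j\<in>{2..n}. ivar s' ''best'' = ei j \<and> (\<forall>j'\<in>{2..n}. fv j \<le> fv j')))"
proof -
  \<comment> \<open>Position 1 has no edge above it, so \<open>best\<close> remains 0 until position
    2 has been treated.\<close>
  define I where "I i s' \<longleftrightarrow> (\<forall>j\<in>{2..i}. rarr s' ''f'' (ei j) = fv j) \<and>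
    (if i < 2 then ivar s' ''best'' = 0
     else \<exists>j\<in>{2..i}. ivar s' ''best'' = ei j \<and> (\<forall>j'\<in>{2..i}. fv j \<le> fv j'))" for i and s' :: state
  show ?thesis
    unfolding evaluate_def
  proof (rule runs_loop[where I = I and k = 61], goal_cases)
    case (6 i s')
    note fr = frameD[OF 6(3)]
    have st: "iarr s' ''ei'' = ei" "rarr s' ''c1'' = rarr s ''c1''" "rarr s' ''c2'' = rarr s ''c2''"
      "rarr s' ''zs'' = rarr s ''zs''" "rvar s' ''lambda'' = rvar s ''lambda''"
      using fr by (simp_all add: ei_def evaluate_body_def)
    have "I (Suc i) (run evaluate_body s')"
    proof (cases "i = 0")
      case True
      then show ?thesis
        using 6(2,4) by (simp add: I_def evaluate_body_def)
    next
      case False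
      let ?s = "run evaluate_body s'" and ?a = "Suc i"
      have a: "?a \<in> {2..n}" using False 6(1) n by auto
      \<comment> \<open>Writing the new value of \<open>f\<close> does not overwrite the one stored
        at \<open>best\<close>, so the comparison is with the old minimum.\<close>
      have inj: "ei j \<noteq> ei ?a" if "j \<in> {2..i}" for j
        using inj_onD[OF ei(1), of j ?a] that a by auto
      have fva: "rvar s ''lambda'' * (rarr s ''c1'' (ei ?a) + rarr s ''c2'' (ei ?a)) +
          (1 - rvar s ''lambda'') * \<bar>rarr s ''zs'' ?a - (rarr s ''zs'' 1 - rarr s ''zs'' ?a)\<bar> = fv ?a"
        by (simp add: fv_def ei_def)
      have f: "rarr ?s ''f'' = (rarr s' ''f'')(ei ?a := fv ?a)"
        unfolding fva[symmetric] using False 6(4)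
        by (simp add: evaluate_body_def st abs_if)
      have b: "ivar ?s ''best'' = (if 0 < ivar s' ''best'' \<and>
          \<not> fv ?a < ((rarr s' ''f'')(ei ?a := fv ?a)) (ivar s' ''best'') then ivar s' ''best'' else ei ?a)"
        unfolding fva[symmetric] using False 6(4)
        by (simp add: evaluate_body_def st abs_if)
      have F: "\<forall>j\<in>{2..?a}. rarr ?s ''f'' (ei j) = fv j"
        using 6(2) inj by (auto simp: I_def f le_Suc_eq)
      have "\<exists>j\<in>{2..?a}. ivar ?s ''best'' = ei j \<and> (\<forall>j'\<in>{2..?a}. fv j \<le> fv j')"
      proof (cases "i < 2")
        case True
        then have "i = 1" using False by simp
        then have single: "{2..?a} = {?a}" by (simp add: numeral_2_eq_2)
        have best': "ivar ?s ''best'' = ei ?a" using 6(2) True by (simp add: I_def b)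
        show ?thesis unfolding single best' by simp
      next
        case i2: False
        then obtain j where j: "j \<in> {2..i}" "ivar s' ''best'' = ei j" "\<forall>j'\<in>{2..i}. fv j \<le> fv j'"
          using 6(2) by (auto simp: I_def)
        have "rarr s' ''f'' (ei j) = fv j" using 6(2) j by (auto simp: I_def)
        moreover have "0 < ei j" using ei(2) j a by auto
        ultimately have b': "ivar ?s ''best'' = (if \<not> fv ?a < fv j then ei j else ei ?a)"
          using b j inj by simp
        show ?thesis
        proof (cases "fv ?a < fv j")
          case True
          have "fv ?a \<le> fv j'" if "j' \<in> {2..?a}" for j'
          proof (cases "j' = ?a")
            case False
            then have "j' \<in> {2..i}" using that by auto
            then have "fv j \<le> fv j'" using j(3) by blast
            then show ?thesis using True by simp
          qed simp
          then show ?thesis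
            using b' True i2 by (intro bexI[of _ ?a]) auto
        next
          case False
          then show ?thesis
            using b' j by (intro bexI[of _ j]) (auto simp: le_Suc_eq)
        qed
      qed
      then show ?thesis using F False by (simp add: I_def)
    qed
    then show ?case
      by (rule runs_run[rotated]) (simp_all add: evaluate_body_def)
  qed (use k n best in \<open>auto simp: I_def evaluate_body_def\<close>)
qed

section \<open>Search order from an unordered edge list\<close>

text \<open>
  State of the search after placing \<open>c\<close> vertices; \<open>pos v = 0\<close> means that \<open>v\<close> is not placed yet.
\<close>

definition partial_search :: "nat set \<Rightarrow> nat \<Rightarrow> (nat \<Rightarrow> nat set) \<Rightarrow> nat \<Rightarrow> (nat \<Rightarrow> nat) \<Rightarrow>
    (nat \<Rightarrow> nat) \<Rightarrow> (nat \<Rightarrow> nat) \<Rightarrow> (nat \<Rightarrow> nat) \<Rightarrow> bool" where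
  "partial_search V m ed c ord pos p ei \<longleftrightarrow> 1 \<le> c \<and>
     (\<forall>j\<in>{1..c}. ord j \<in> V \<and> pos (ord j) = j) \<and>
     (\<forall>v\<in>V. pos v \<le> c \<and> (0 < pos v \<longrightarrow> ord (pos v) = v)) \<and>
     (\<forall>j\<in>{2..c}. 1 \<le> p j \<and> p j < j \<and> ei j \<in> {1..m} \<and> ed (ei j) = {ord j, ord (p j)})"

text \<open>\<open>pos b = 0\<close> makes \<open>b\<close> different from every placed vertex, and
  \<open>pos a \<le> c\<close> puts the parent before the new position \<open>Suc c\<close>.\<close>

lemma partial_search_add:
  assumes "partial_search V m ed c ord pos p ei" "a \<in> V" "b \<in> V" "0 < pos a" "pos b = 0"
    "k \<in> {1..m}" "ed k = {b, a}"
  shows "partial_search V m ed (Suc c) (ord(Suc c := b)) (pos(b := Suc c)) (p(Suc c := pos a))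
    (ei(Suc c := k))"
proof -
  have 1: "1 \<le> c" and 2: "\<And>j. j \<in> {1..c} \<Longrightarrow> ord j \<in> V \<and> pos (ord j) = j"
    and 3: "\<And>v. v \<in> V \<Longrightarrow> pos v \<le> c \<and> (0 < pos v \<longrightarrow> ord (pos v) = v)"
    and 4: "\<And>j. j \<in> {2..c} \<Longrightarrow> 1 \<le> p j \<and> p j < j \<and> ei j \<in> {1..m} \<and> ed (ei j) = {ord j, ord (p j)}"
    using assms(1) by (auto simp: partial_search_def)
  have nb: "ord j \<noteq> b" if "j \<in> {1..c}" for j using 2[OF that] that assms(5) by auto
  have pa: "pos a \<le> c" "ord (pos a) = a" using 3[OF assms(2)] assms(4) by auto
  show ?thesis
    unfolding partial_search_def
  proof (intro conjI ballI)
    show "1 \<le> Suc c" by simp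
  next
    fix j assume "j \<in> {1..Suc c}"
    then consider "j \<in> {1..c}" | "j = Suc c" by force
    then show "(ord(Suc c := b)) j \<in> V" "(pos(b := Suc c)) ((ord(Suc c := b)) j) = j"
      using 2[of j] nb[of j] assms(3) by (cases; simp)+
  next
    fix v assume v: "v \<in> V"
    show "(pos(b := Suc c)) v \<le> Suc c" using 3[OF v] by simp
    show "0 < (pos(b := Suc c)) v \<longrightarrow> (ord(Suc c := b)) ((pos(b := Suc c)) v) = v"
      using 3[OF v] by auto
  next
    fix j assume "j \<in> {2..Suc c}"
    then consider "j \<in> {2..c}" | "j = Suc c" by force
    then have "1 \<le> (p(Suc c := pos a)) j \<and> (p(Suc c := pos a)) j < j \<and>
        (ei(Suc c := k)) j \<in> {1..m} \<and>
        ed ((ei(Suc c := k)) j) = {(ord(Suc c := b)) j, (ord(Suc c := b)) ((p(Suc c := pos a)) j)}"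
    proof cases
      case 1
      then have "j \<noteq> Suc c" "p j \<noteq> Suc c" using 4[OF 1] by auto
      then show ?thesis using 4[OF 1] by simp
    next
      case 2
      then show ?thesis using pa assms(4,6,7) by auto
    qed
    then show "1 \<le> (p(Suc c := pos a)) j" "(p(Suc c := pos a)) j < j"
      "(ei(Suc c := k)) j \<in> {1..m}"
      "ed ((ei(Suc c := k)) j) = {(ord(Suc c := b)) j, (ord(Suc c := b)) ((p(Suc c := pos a)) j)}"
      by simp_all
  qed
qed

lemma partial_search_inj:
  assumes "partial_search V m ed c ord pos p ei"
  shows "inj_on ord {1..c}" "ord ` {1..c} \<subseteq> V" "ord ` {1..c} = {v \<in> V. 0 < pos v}"
proof -
  show "inj_on ord {1..c}"
    using assms unfolding partial_search_def inj_on_def by metis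
  show sub: "ord ` {1..c} \<subseteq> V"
    using assms by (auto simp: partial_search_def)
  show "ord ` {1..c} = {v \<in> V. 0 < pos v}"
  proof
    show "ord ` {1..c} \<subseteq> {v \<in> V. 0 < pos v}"
      using assms by (auto simp: partial_search_def)
    show "{v \<in> V. 0 < pos v} \<subseteq> ord ` {1..c}"
    proof
      fix v assume "v \<in> {v \<in> V. 0 < pos v}"
      then have "v = ord (pos v)" "pos v \<in> {1..c}" using assms by (auto simp: partial_search_def)
      then show "v \<in> ord ` {1..c}" by blast
    qed
  qed
qed

lemma partial_search_card:
  assumes "partial_search V m ed c ord pos p ei" "finite V"
  shows "c \<le> card V"
  using card_image[OF partial_search_inj(1)[OF assms(1)]]
    card_mono[OF assms(2) partial_search_inj(2)[OF assms(1)]] by simp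

text \<open>The placed vertices contain the root and are closed under adjacency; following a path
  from the root to any vertex shows that it is placed.\<close>

lemma partial_search_complete:
  assumes po: "partial_search V m ed c ord pos p ei" and tree: "is_tree V E"
    and edges: "ed ` {1..m} = E"
    and closed: "\<And>k a b. k \<in> {1..m} \<Longrightarrow> ed k = {a, b} \<Longrightarrow> 0 < pos a \<Longrightarrow> 0 < pos b"
  shows "card V \<le> c"
proof -
  have "0 < pos v" if v: "v \<in> V" for v
  proof -
    have r: "ord 1 \<in> V" "pos (ord 1) = 1" using po by (auto simp: partial_search_def)
    have "\<forall>u\<in>V. \<forall>v\<in>V. \<exists>xs. is_path V E u xs v" using tree by (simp add: is_tree_def)
    then obtain xs where xs: "is_path V E (ord 1) xs v" using r(1) v by blast
    have "0 < pos (last xs)"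
    proof (rule successively_invariant[where R = "\<lambda>x y. {x, y} \<in> E" and P = "\<lambda>v. 0 < pos v"])
      fix x y assume "{x, y} \<in> E" "0 < pos x"
      moreover from this obtain k where "k \<in> {1..m}" "ed k = {x, y}" unfolding edges[symmetric] by auto
      ultimately show "0 < pos y" using closed by blast
    qed (use xs r in \<open>auto simp: is_path_def\<close>)
    then show ?thesis using xs by (simp add: is_path_def)
  qed
  then have "ord ` {1..c} = V" using partial_search_inj(3)[OF po] by auto
  then show ?thesis using card_image[OF partial_search_inj(1)[OF po]] by simp
qed

abbreviation partial_search_in :: "nat set \<Rightarrow> nat \<Rightarrow> (nat \<Rightarrow> nat set) \<Rightarrow> state \<Rightarrow> bool" where
  "partial_search_in V m ed s \<equiv> partial_search V m ed (ivar s ''c'') (iarr s ''ord'') (iarr s ''pos'')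
     (iarr s ''pp'') (iarr s ''ei'')"

definition crosses :: "state \<Rightarrow> nat \<Rightarrow> bool" where
  "crosses s k \<longleftrightarrow> (0 < iarr s ''pos'' (iarr s ''u'' k)) \<noteq> (0 < iarr s ''pos'' (iarr s ''v'' k))"

lemma run_search_body_idle:
  assumes "\<not> crosses s (ivar s ''k'')"
  shows "ivar (run search_body s) ''c'' = ivar s ''c''" "iarr (run search_body s) = iarr s"
  using assms by (auto simp: search_body_def crosses_def)

lemma run_search_body_add:
  assumes po: "partial_search_in V m (input_edge s) s" and k: "ivar s ''k'' \<in> {1..m}"
    and V: "\<forall>k\<in>{1..m}. input_edge s k \<subseteq> V" and cr: "crosses s (ivar s ''k'')"
  shows "partial_search_in V m (input_edge s) (run search_body s)"
    and "ivar (run search_body s) ''c'' = Suc (ivar s ''c'')"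
proof -
  let ?k = "ivar s ''k''"
  let ?u = "iarr s ''u'' ?k" and ?v = "iarr s ''v'' ?k" and ?pos = "iarr s ''pos''"
  define a where "a = (if 0 < ?pos ?u then ?u else ?v)"
  define b where "b = (if 0 < ?pos ?u then ?v else ?u)"
  have ab: "0 < ?pos a" "?pos b = 0" "input_edge s ?k = {b, a}"
    using cr by (auto simp: crosses_def a_def b_def input_edge_def split: if_splits)
  have "input_edge s ?k \<subseteq> V" using V k by blast
  then have "a \<in> V" "b \<in> V" unfolding ab(3) by simp_all
  note add = partial_search_add[OF po this ab(1,2) k ab(3)]
  have ne: "a \<noteq> b" using ab by auto
  have eq: "ivar (run search_body s) ''c'' = Suc (ivar s ''c'')"
    "iarr (run search_body s) ''ord'' = (iarr s ''ord'')(Suc (ivar s ''c'') := b)"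
    "iarr (run search_body s) ''pos'' = ?pos(b := Suc (ivar s ''c''))"
    "iarr (run search_body s) ''pp'' = (iarr s ''pp'')(Suc (ivar s ''c'') := ?pos a)"
    "iarr (run search_body s) ''ei'' = (iarr s ''ei'')(Suc (ivar s ''c'') := ?k)"
    using ab ne by (auto simp: search_body_def a_def b_def)
  show "partial_search_in V m (input_edge s) (run search_body s)"
    using add by (simp add: eq)
  show "ivar (run search_body s) ''c'' = Suc (ivar s ''c'')" by (fact eq)
qed

lemma search_body_mods [simp]:
  "ivars_mod search_body = {''a'', ''b'', ''c''}"
  "iarrs_mod search_body = {''ord'', ''pos'', ''pp'', ''ei''}"
  by (auto simp: search_body_def)

lemma runs_search_pass:
  assumes tree: "is_tree V E" and edges: "input_edge s ` {1..m} = E" and m: "m = ivar s ''m''"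
    and po: "partial_search_in V m (input_edge s) s" and c: "min (card V) i \<le> ivar s ''c''"
    and k: "54 * m + 7 \<le> k"
  shows "runs (loop ''k'' ''m'' search_body) s k
    (\<lambda>s'. partial_search_in V m (input_edge s) s' \<and> min (card V) (Suc i) \<le> ivar s' ''c'')"
proof -
  \<comment> \<open>Either this sweep has already gained the required vertex, or no edge scanned so
    far crosses. The latter persists because an edge that does not cross leaves \<open>pos\<close>
    untouched, and at the end it forces completeness.\<close>
  define I where "I k s' \<longleftrightarrow> partial_search_in V m (input_edge s) s' \<and>
      min (card V) i \<le> ivar s' ''c'' \<and>
      (min (card V) (Suc i) \<le> ivar s' ''c'' \<or> (\<forall>k'\<in>{1..k}. \<not> crosses s' k'))"
    for k and s' :: state
  have V: "\<forall>k\<in>{1..m}. input_edge s k \<subseteq> V" using tree edges by (auto simp: is_tree_def)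
  show ?thesis
  proof (rule runs_loop[where I = I and k = 45], goal_cases)
    case (6 k s')
    note fr = frameD[OF 6(3)]
    have "iarr s' ''u'' = iarr s ''u''" "iarr s' ''v'' = iarr s ''v''" using fr by simp_all
    then have ie: "input_edge s' = input_edge s" by (simp add: input_edge_def fun_eq_iff)
    have "I (Suc k) (run search_body s')"
    proof (cases "crosses s' (Suc k)")
      case True
      have "partial_search_in V m (input_edge s) s'" "ivar s' ''k'' \<in> {1..m}"
        using 6 m by (auto simp: I_def)
      then show ?thesis
        using run_search_body_add[of V m s'] V True 6(2,4) ie by (auto simp: I_def)
    next
      case False
      have *: "crosses (run search_body s') k' = crosses s' k'" for k'
        using run_search_body_idle[of s'] False 6(4) by (simp add: crosses_def)
      show ?thesis
        unfolding I_def *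
        using run_search_body_idle[of s'] False 6(2,4) by (auto simp: I_def le_Suc_eq)
    qed
    then show ?case by (rule runs_run[rotated]) (simp_all add: search_body_def)
  next
    case (7 s')
    note fr = frameD[OF 7(2)]
    have po': "partial_search_in V m (input_edge s) s'" using 7(1) by (simp add: I_def)
    have uv: "iarr s' ''u'' = iarr s ''u''" "iarr s' ''v'' = iarr s ''v''" using fr by simp_all
    have "min (card V) (Suc i) \<le> ivar s' ''c''"
    proof (rule ccontr)
      assume "\<not> ?thesis"
      moreover from this have "\<forall>k'\<in>{1..m}. \<not> crosses s' k'" using 7(1) m by (simp add: I_def)
      then have "card V \<le> ivar s' ''c''"
        by (intro partial_search_complete[OF po' tree edges])
          (auto simp: crosses_def uv input_edge_def doubleton_eq_iff)
      ultimately show False by simp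
    qed
    then show ?case using po' by simp
  qed (use k m po c in \<open>auto simp: I_def crosses_def\<close>)
qed

lemma runs_search:
  assumes valid: "valid_instance I" and enc: "encodes s I"
    and n: "n = num_verts I" and m: "m = card (edges I)" and k: "n * (54 * m + 28) + 29 \<le> k"
  shows "runs search s k (\<lambda>s'. bij_betw (iarr s' ''ord'') {1..n} (verts I) \<and>
    (\<forall>j\<in>{2..n}. 1 \<le> iarr s' ''pp'' j \<and> iarr s' ''pp'' j < j \<and> iarr s' ''ei'' j \<in> {1..m} \<and>
      input_edge s (iarr s' ''ei'' j) = {iarr s' ''ord'' j, iarr s' ''ord'' (iarr s' ''pp'' j)}))"
    (is "runs search s k ?Q")
proof -
  have tree: "is_tree (verts I) (edges I)" and n2: "2 \<le> n"
    using valid n by (auto simp: valid_instance_def)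
  have edges: "input_edge s ` {1..m} = edges I" and st: "ivar s ''n'' = n" "ivar s ''m'' = m"
    using enc n m by (auto simp: encodes_def bij_betw_def)
  have verts: "verts I = {1..n}" by (simp add: verts_def n)
  have clear: "runs clear_pos s (12 * n + 7) (\<lambda>s'. \<forall>v\<in>{1..n}. iarr s' ''pos'' v = 0)"
    unfolding clear_pos_def
  proof (rule runs_loop[where k = 3 and I = "\<lambda>i s'. \<forall>v\<in>{1..i}. iarr s' ''pos'' v = 0"], goal_cases)
    case (6 i s')
    then show ?case by (intro runs_run) auto
  qed (use st in auto)
  show ?thesis
    unfolding search_def
  proof (rule runs_Seq[OF clear, where ?k2.0 = "n * (54 * m + 16) + 15"], goal_cases)
    case (1 s1)
    note fr1 = frameD[OF 1(2)]
    have st1: "ivar s1 ''n'' = n" "ivar s1 ''m'' = m" "iarr s1 ''u'' = iarr s ''u''" "iarr s1 ''v'' = iarr s ''v''"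
      using fr1 st by (simp_all add: clear_pos_def)
    define s2 where "s2 = run place_root s1"
    have st2: "ivar s2 ''n'' = n" "ivar s2 ''m'' = m" "iarr s2 ''u'' = iarr s ''u''" "iarr s2 ''v'' = iarr s ''v''"
      using st1 by (simp_all add: s2_def place_root_def)
    have po2: "partial_search_in (verts I) m (input_edge s) s2"
      using 1(1) n2 unfolding partial_search_def verts
      by (auto simp: s2_def place_root_def)
    have c2: "ivar s2 ''c'' = 1" by (simp add: s2_def place_root_def)
    have search: "runs (loop ''r'' ''n'' (loop ''k'' ''m'' search_body)) s2 (n * (54 * m + 16) + 7) ?Q"
    \<comment> \<open>The invariant says \<open>Suc i\<close> instead of \<open>i\<close> because
      the root is placed before the first sweep.\<close>
    proof (rule runs_loop[where k = "54 * m + 7" and I = "\<lambda>i s'.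
        partial_search_in (verts I) m (input_edge s) s' \<and> min n (Suc i) \<le> ivar s' ''c''"], goal_cases)
      case (6 i s')
      note fr = frameD[OF 6(3)]
      have uv: "iarr s' ''u'' = iarr s ''u''" "iarr s' ''v'' = iarr s ''v''" and m': "ivar s' ''m'' = m"
        using fr st2 by simp_all
      then have ie: "input_edge s' = input_edge s" by (simp add: input_edge_def fun_eq_iff)
      have "runs (loop ''k'' ''m'' search_body) s' (54 * m + 7) (\<lambda>s''.
          partial_search_in (verts I) m (input_edge s') s'' \<and>
          min (card (verts I)) (Suc (Suc i)) \<le> ivar s'' ''c'')"
      proof (rule runs_search_pass[OF tree])
        show "input_edge s' ` {1..m} = edges I" using ie edges by simp
        show "min (card (verts I)) (Suc i) \<le> ivar s' ''c''" using 6(2) verts by simp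
      qed (use 6(2) ie m' in simp_all)
      then show ?case using ie verts by simp
    next
      case (7 s')
      have po: "partial_search_in (verts I) m (input_edge s) s'" using 7 by simp
      have "ivar s' ''c'' \<le> n" using partial_search_card[OF po] verts by simp
      then have c: "ivar s' ''c'' = n" using 7(1) st2 by simp
      have "ord ` {1..n} = verts I" if "inj_on ord {1..n}" "ord ` {1..n} \<subseteq> verts I" for ord
        using that card_subset_eq[of "verts I" "ord ` {1..n}"] card_image[OF that(1)] verts by simp
      then have "bij_betw (iarr s' ''ord'') {1..n} (verts I)"
        using partial_search_inj(1,2)[OF po] c by (simp add: bij_betw_def)
      then show ?case using po c by (simp add: partial_search_def)
    qed (use po2 c2 st2 in \<open>auto simp: algebra_simps\<close>)
    have "runs place_root s1 8 (\<lambda>s'. s' = s2)"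
      by (rule runs_run) (simp_all add: place_root_def s2_def)
    then show ?case
      by (rule runs_Seq[where ?k2.0 = "n * (54 * m + 16) + 7"]) (use search in simp_all)
  qed (use k in \<open>auto simp: algebra_simps\<close>)
qed

section \<open>From positions back to the instance, and the whole program\<close>

lemma (in parents) tdist_cong:
  assumes "\<And>j. j \<in> {2..n} \<Longrightarrow> l j = l' j" "x \<in> {1..n}" "y \<in> {1..n}"
  shows "tdist p l x y = tdist p l' x y"
  using assms(2,3)
proof (induction "x + y" arbitrary: x y rule: less_induct)
  case less
  consider "x < y" | "y < x" | "x = y" by linarith
  then show ?case
  proof cases
    case 1
    then have "y \<in> {2..n}" "p y \<in> {1..n}" "p y < y" using parent[of y] less.prems by auto
    then show ?thesis
      using less.hyps[of x "p y"] 1 less.prems assms(1)[of y] tdist_parent1[of x y] by simp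
  next
    case 2
    then have "x \<in> {2..n}" "p x \<in> {1..n}" "p x < x" using parent[of x] less.prems by auto
    then show ?thesis
      using less.hyps[of "p x" y] 2 less.prems assms(1)[of x] tdist_parent2[of y x] by simp
  qed simp
qed

lemma is_min_cong:
  "(\<And>y. y \<in> S \<Longrightarrow> f y = g y) \<Longrightarrow> is_min ord S f M C = is_min ord S g M C"
  by (simp add: is_min_def)

locale numbered_instance = search_order n p "verts I" "edges I" ord
  for n :: nat and p I and ord :: "nat \<Rightarrow> nat" +
  assumes valid: "valid_instance I"
begin

abbreviation plen :: "nat \<Rightarrow> real" where "plen j \<equiv> edge_len I (pedge j)"

lemma dst_ord: "x \<in> {1..n} \<Longrightarrow> y \<in> {1..n} \<Longrightarrow> dst I (ord x) (ord y) = tdist p plen x y"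
  unfolding dst_def using valid by (intro sp_dist_eq_tdist) (auto simp: valid_instance_def)

lemma inj_on_ord: "S \<subseteq> {1..n} \<Longrightarrow> inj_on ord S"
  using bij inj_on_subset by (auto simp: bij_betw_def)

lemma median_cost_ord:
  assumes S: "S \<subseteq> {1..n}" and y: "y \<in> {1..n}"
  shows "median_cost I (ord ` S) (ord y) = side_cost p ord (weight I) plen S y"
proof -
  have "median_cost I (ord ` S) (ord y) = (\<Sum>i\<in>S. weight I (ord i) * dst I (ord i) (ord y))"
    by (simp add: median_cost_def sum.reindex[OF inj_on_ord[OF S]])
  also have "\<dots> = (\<Sum>i\<in>S. weight I (ord i) * tdist p plen y i)"
  proof (rule sum.cong)
    fix i assume "i \<in> S"
    then have "i \<in> {1..n}" using S by blast
    then show "weight I (ord i) * dst I (ord i) (ord y) = weight I (ord i) * tdist p plen y i"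
      using dst_ord[of i y] y tdist_commute[of p plen i y] by simp
  qed simp
  finally show ?thesis by (simp add: side_cost_def)
qed

lemma one_median_of_is_min:
  assumes S: "S \<subseteq> {1..n}" "S \<noteq> {}"
    and min: "is_min ord S (side_cost p ord (weight I) plen S) M C"
  shows "one_median I (ord ` S) M" "median_cost I (ord ` S) M = C"
proof -
  obtain y where y: "y \<in> S" "M = ord y" "C = side_cost p ord (weight I) plen S y"
    and le: "\<forall>y'\<in>S. side_cost p ord (weight I) plen S y \<le> side_cost p ord (weight I) plen S y'"
    using min S(2) by (auto simp: is_min_def)
  have cost: "median_cost I (ord ` S) (ord y') = side_cost p ord (weight I) plen S y'" if "y' \<in> S" for y'
    using median_cost_ord[OF S(1), of y'] that S(1) by blast
  show "median_cost I (ord ` S) M = C" using cost y by simp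
  show "one_median I (ord ` S) M"
    using y le cost by (auto simp: one_median_def)
qed

lemma splits_pedge:
  assumes "j \<in> {2..n}"
  shows "splits I (pedge j) (ord ` subtree p n j) (ord ` ({1..n} - subtree p n j))"
  using assms edge[of j] components_delete[of j] subtree_images_neq[of j] by (simp add: splits_def)

text \<open>Collects what the final memory must satisfy to represent a run of the method. The lower
  side of each edge is named \<open>T1\<close> and the rest \<open>T2\<close>.\<close>

lemma edge_deletion_result:
  assumes ei: "bij_betw ei {2..n} {1..card (edges I)}"
    and ie: "\<And>j. j \<in> {2..n} \<Longrightarrow> input_edge s (ei j) = pedge j"
    and mins: "\<And>j. j \<in> {2..n} \<Longrightarrow> sides_min n p ord ei (weight I) plen s' j n"
    and f: "\<And>j. j \<in> {2..n} \<Longrightarrow> rarr s' ''f'' (ei j) =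
      lam I * (rarr s' ''c1'' (ei j) + rarr s' ''c2'' (ei j)) +
      (1 - lam I) * \<bar>(\<Sum>i\<in>subtree p n j. z I (ord i)) -
        ((\<Sum>i\<in>subtree p n 1. z I (ord i)) - (\<Sum>i\<in>subtree p n j. z I (ord i)))\<bar>"
    and j0: "j0 \<in> {2..n}" "ivar s' ''best'' = ei j0"
      "\<And>j. j \<in> {2..n} \<Longrightarrow> rarr s' ''f'' (ei j0) \<le> rarr s' ''f'' (ei j)"
    and x: "ivar s' ''x1'' = iarr s' ''m1'' (ei j0)" "ivar s' ''x2'' = iarr s' ''m2'' (ei j0)"
  shows "\<exists>T1 T2 m1 m2 e. edge_deletion_run I T1 T2 m1 m2 e \<and> outputs s s' I T1 T2 m1 m2 e"
proof -
  \<comment> \<open>A run assigns subtrees and medians to edges, while the program works by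
    position; the inverse of \<open>pedge\<close> translates.\<close>
  define pos where "pos = the_inv_into {2..n} pedge"
  have pos: "pos (pedge j) = j" if "j \<in> {2..n}" for j
    unfolding pos_def using the_inv_into_f_f[OF pedge_inj that] .
  define T1 where "T1 e = ord ` subtree p n (pos e)" for e
  define T2 where "T2 e = ord ` ({1..n} - subtree p n (pos e))" for e
  define m1 where "m1 e = iarr s' ''m1'' (ei (pos e))" for e
  define m2 where "m2 e = iarr s' ''m2'' (ei (pos e))" for e
  have edge: "splits I (pedge j) (T1 (pedge j)) (T2 (pedge j)) \<and>
      one_median I (T1 (pedge j)) (m1 (pedge j)) \<and> one_median I (T2 (pedge j)) (m2 (pedge j)) \<and>
      f_pmed I (T1 (pedge j)) (T2 (pedge j)) (m1 (pedge j)) (m2 (pedge j)) = rarr s' ''f'' (ei j)"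
    if j: "j \<in> {2..n}" for j
  proof -
    let ?S1 = "subtree p n j" and ?S2 = "{1..n} - subtree p n j"
    have S: "?S1 \<subseteq> {1..n}" "?S2 \<subseteq> {1..n}" using subtree_subset by auto
    have "j \<in> ?S1" "1 \<in> ?S2" using subtree_self[of j] subtree_ge[of 1 j] j by auto
    then have ne: "?S1 \<noteq> {}" "?S2 \<noteq> {}" by blast+
    have "{1..n} \<inter> ?S1 = ?S1" using S by blast
    then have min: "is_min ord ?S1 (side_cost p ord (weight I) plen ?S1) (iarr s' ''m1'' (ei j)) (rarr s' ''c1'' (ei j))"
      "is_min ord ?S2 (side_cost p ord (weight I) plen ?S2) (iarr s' ''m2'' (ei j)) (rarr s' ''c2'' (ei j))"
      using mins[OF j] by (simp_all add: sides_min_def)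
    note med = one_median_of_is_min[OF S(1) ne(1) min(1)] one_median_of_is_min[OF S(2) ne(2) min(2)]
    have z1: "(\<Sum>i\<in>ord ` ?S1. z I i) = (\<Sum>i\<in>?S1. z I (ord i))"
      by (simp add: sum.reindex[OF inj_on_ord[OF S(1)]])
    have "(\<Sum>i\<in>?S2. z I (ord i)) = (\<Sum>i\<in>subtree p n 1. z I (ord i)) - (\<Sum>i\<in>?S1. z I (ord i))"
      unfolding subtree_root by (rule sum_diff) (use S in auto)
    then have z2: "(\<Sum>i\<in>ord ` ?S2. z I i) =
        (\<Sum>i\<in>subtree p n 1. z I (ord i)) - (\<Sum>i\<in>?S1. z I (ord i))"
      unfolding sum.reindex[OF inj_on_ord[OF S(2)]] o_def .
    have "f_pmed I (ord ` ?S1) (ord ` ?S2) (iarr s' ''m1'' (ei j)) (iarr s' ''m2'' (ei j)) = rarr s' ''f'' (ei j)"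
      using med(2,4) unfolding f_pmed_def z1 z2 f[OF j] by (simp only: median_cost_def)
    then show ?thesis
      using splits_pedge[OF j] med(1,3) pos[OF j] by (simp add: T1_def T2_def m1_def m2_def)
  qed
  have run: "edge_deletion_run I T1 T2 m1 m2 (pedge j0)"
    unfolding edge_deletion_run_def
  proof (intro conjI ballI)
    fix e assume "e \<in> edges I"
    then obtain j where j: "j \<in> {2..n}" "e = pedge j" by (rule edgeE)
    show "splits I e (T1 e) (T2 e)" "one_median I (T1 e) (m1 e)" "one_median I (T2 e) (m2 e)"
      unfolding j(2) using edge[OF j(1)] by simp_all
    show "f_pmed I (T1 (pedge j0)) (T2 (pedge j0)) (m1 (pedge j0)) (m2 (pedge j0)) \<le>
        f_pmed I (T1 e) (T2 e) (m1 e) (m2 e)"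
      unfolding j(2) using edge[OF j(1)] edge[OF j0(1)] j0(3)[OF j(1)] by simp
  next
    show "pedge j0 \<in> edges I" using splits_pedge[OF j0(1)] by (simp add: splits_def)
  qed
  have "outputs s s' I T1 T2 m1 m2 (pedge j0)"
    unfolding outputs_def Let_def
  proof (intro conjI ballI)
    fix k assume "k \<in> {1..card (edges I)}"
    then have "k \<in> ei ` {2..n}" using bij_betw_imp_surj_on[OF ei] by simp
    then obtain j where j: "j \<in> {2..n}" "k = ei j" by blast
    show "iarr s' ''m1'' k = m1 (input_edge s k)" "iarr s' ''m2'' k = m2 (input_edge s k)"
      unfolding j(2) ie[OF j(1)] using pos[OF j(1)] by (simp_all add: m1_def m2_def)
    show "rarr s' ''f'' k = f_pmed I (T1 (input_edge s k)) (T2 (input_edge s k))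
        (m1 (input_edge s k)) (m2 (input_edge s k))"
      unfolding j(2) ie[OF j(1)] using edge[OF j(1)] by simp
  next
    show "ivar s' ''best'' \<in> {1..card (edges I)}"
      unfolding j0(2) using bij_betwE[OF ei] j0(1) by blast
    show "input_edge s (ivar s' ''best'') = pedge j0" unfolding j0(2) by (rule ie[OF j0(1)])
    show "ivar s' ''x1'' = m1 (pedge j0)" "ivar s' ''x2'' = m2 (pedge j0)"
      using x pos[OF j0(1)] by (simp_all add: m1_def m2_def)
  qed
  with run show ?thesis by blast
qed

end

text \<open>The search contributes 54 and the \<open>n\<close> scans 163 to the quadratic
  coefficient. The linear terms of search, preprocessing, \<open>accumulate\<close>, scans and
  evaluation are 28 + 37 + 28 + 44 + 70, and the constants 29 + 7 + 7 + 7 + 15, the last 15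
  including the final assignments.\<close>

lemma runs_edge_deletion:
  assumes valid: "valid_instance I" and enc: "encodes s I" and n: "n = num_verts I"
  shows "runs edge_deletion s (217 * n * n + 207 * n + 65)
    (\<lambda>s'. \<exists>T1 T2 m1 m2 e. edge_deletion_run I T1 T2 m1 m2 e \<and> outputs s s' I T1 T2 m1 m2 e)"
    (is "runs _ _ _ ?Q")
proof -
  define m where "m = card (edges I)"
  \<comment> \<open>The state after the search is fixed here because its arrays are the parameters
    of the locale interpreted below; the execution re-enters as a \<open>runs\<close> statement with
    postcondition \<open>s' = s1\<close>.\<close>
  obtain k1 s1 where exec1: "exec search s k1 s1" and k1: "k1 \<le> n * (54 * m + 28) + 29"
    and bij: "bij_betw (iarr s1 ''ord'') {1..n} (verts I)"
    and post1: "\<forall>j\<in>{2..n}. 1 \<le> iarr s1 ''pp'' j \<and> iarr s1 ''pp'' j < j \<and> iarr s1 ''ei'' j \<in> {1..m} \<and>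
      input_edge s (iarr s1 ''ei'' j) = {iarr s1 ''ord'' j, iarr s1 ''ord'' (iarr s1 ''pp'' j)}"
    using runs_search[OF valid enc n m_def order_refl] by (auto simp: runs_def)
  define p ord ei where "p = iarr s1 ''pp''" and "ord = iarr s1 ''ord''" and "ei = iarr s1 ''ei''"
  note abbr = p_def[symmetric] ord_def[symmetric] ei_def[symmetric]
  have verts: "verts I = {1..n}" by (simp add: verts_def n)
  have edges: "input_edge s ` {1..m} = edges I"
    using enc by (auto simp: encodes_def m_def bij_betw_def)
  have post: "1 \<le> p j" "p j < j" "ei j \<in> {1..m}" "input_edge s (ei j) = {ord j, ord (p j)}"
    if "j \<in> {2..n}" for j
    using post1 that unfolding abbr by blast+
  interpret numbered_instance n p I ord
  proof
    show "bij_betw ord {1..n} (verts I)" using bij unfolding abbr .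
    show "is_tree (verts I) (edges I)" using valid by (simp add: valid_instance_def)
    fix j assume j: "2 \<le> j" "j \<le> n"
    then show "1 \<le> p j \<and> p j < j" using post[of j] by simp
    have "input_edge s (ei j) \<in> input_edge s ` {1..m}" using post(3)[of j] j by simp
    then show "{ord j, ord (p j)} \<in> edges I" using post(4)[of j] j unfolding edges by simp
  qed (fact valid)
  have m: "m = n - 1"
  proof -
    have "m = card (pedge ` {2..n})" unfolding m_def edges_eq[symmetric] ..
    then show ?thesis by (simp add: card_image[OF pedge_inj])
  qed
  have n2: "2 \<le> n" using valid n by (simp add: valid_instance_def)
  have inj: "inj_on ei {2..n}"
  proof (rule inj_onI)
    fix i j assume ij: "i \<in> {2..n}" "j \<in> {2..n}" "ei i = ei j"
    then have "pedge i = pedge j" using post(4)[of i] post(4)[of j] by simp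
    then show "i = j" using inj_onD[OF pedge_inj] ij by blast
  qed
  have ei_pos: "0 < ei j" if "j \<in> {2..n}" for j
    using post(3)[OF that] by simp
  \<comment> \<open>Injectivity and equal cardinality \<open>n - 1\<close> give surjectivity: each
    input edge is the parent edge of some position.\<close>
  have ei_bij: "bij_betw ei {2..n} {1..m}"
  proof -
    have "ei ` {2..n} \<subseteq> {1..m}" using post(3) by blast
    then have "ei ` {2..n} = {1..m}"
      using m by (intro card_subset_eq) (simp_all add: card_image[OF inj])
    then show ?thesis using inj by (simp add: bij_betw_def)
  qed
  have ord_pos: "\<forall>j\<in>{1..n}. 0 < ord j" using ord_image verts by force
  note fr1 = frameD[OF exec_frame[OF exec1]]
  have st1: "ivar s1 ''n'' = n" "rvar s1 ''lambda'' = lam I" "rarr s1 = rarr s"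
    using fr1 enc n by (simp_all add: encodes_def fun_eq_iff)
  define w t l where "w = rarr s ''w''" and "t = rarr s ''t''" and "l = (\<lambda>j. rarr s ''len'' (ei j))"
  have w: "w (ord j) = weight I (ord j)" "t (ord j) = service I (ord j)" if "j \<in> {1..n}" for j
  proof -
    have "ord j \<in> verts I" using that ord_image by blast
    then show "w (ord j) = weight I (ord j)" "t (ord j) = service I (ord j)"
      using enc by (simp_all add: encodes_def w_def t_def)
  qed
  \<comment> \<open>Agreement is available only for positions that have a parent edge, which is why
    \<open>tdist_cong\<close> asks for it on \<open>{2..n}\<close>.\<close>
  have l: "l j = plen j" if "j \<in> {2..n}" for j
  proof -
    have "rarr s ''len'' (ei j) = edge_len I (input_edge s (ei j))"
      using enc post(3)[OF that] by (simp add: encodes_def m_def)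
    then show ?thesis using post(4)[OF that] by (simp add: l_def)
  qed
  have side: "side_cost p ord w l S y = side_cost p ord (weight I) plen S y"
    if "S \<subseteq> {1..n}" "y \<in> {1..n}" for S y
    unfolding side_cost_def
  proof (rule sum.cong)
    fix i assume "i \<in> S"
    then have "i \<in> {1..n}" using that(1) by blast
    then show "w (ord i) * tdist p l y i = weight I (ord i) * tdist p plen y i"
      using w tdist_cong[of l plen, OF l] that(2) by simp
  qed simp
  have sides: "sides_min n p ord ei (weight I) plen s' j n \<longleftrightarrow> sides_min n p ord ei w l s' j n" for s' j
    using side[OF subtree_subset] side[of "{1..n} - subtree p n j"] subtree_subset
    unfolding sides_min_def by (intro conj_cong is_min_cong) auto
  have zsum: "(\<Sum>i\<in>subtree p n j. w (ord i) * t (ord i)) = (\<Sum>i\<in>subtree p n j. z I (ord i))" for j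
    using w by (intro sum.cong) (auto simp: subtree_def z_def)

  let ?fin = "Seq (ISet ''x1'' (IArr ''m1'' (IVar ''best''))) (ISet ''x2'' (IArr ''m2'' (IVar ''best'')))"
  have fin: "runs (Seq (ISet ''best'' (IConst 0)) (Seq evaluate ?fin)) s4 (70 * n + 15) ?Q"
    if st: "ivar s4 ''n'' = n" "iarr s4 ''ei'' = ei" "rvar s4 ''lambda'' = lam I"
      and zs: "\<forall>c\<in>{1..n}. rarr s4 ''zs'' c = (\<Sum>i\<in>subtree p n c. z I (ord i))"
      and mins: "\<forall>j\<in>{2..n}. sides_min n p ord ei w l s4 j n" for s4
  proof -
    define s5 where "s5 = s4\<lparr>ivar := (ivar s4)(''best'' := 0)\<rparr>"
    have init: "runs (ISet ''best'' (IConst 0)) s4 2 (\<lambda>s'. s' = s5)"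
      by (rule runs_run) (simp_all add: s5_def)
    have rest: "runs (Seq evaluate ?fin) s5 (70 * n + 13) ?Q"
    proof (rule runs_Seq[OF runs_evaluate[OF _ n2 _ _ _ order_refl], where ?k2.0 = 6], goal_cases)
      case (5 s6)
      note fr = frameD[OF 5(2)]
      have arrs: "iarr s6 = iarr s4" "rarr s6 ''c1'' = rarr s4 ''c1''" "rarr s6 ''c2'' = rarr s4 ''c2''"
        using fr by (simp_all add: s5_def fun_eq_iff)
      define s' where "s' = run ?fin s6"
      have s': "iarr s' = iarr s4" "rarr s' = rarr s6" "ivar s' ''best'' = ivar s6 ''best''"
        "ivar s' ''x1'' = iarr s4 ''m1'' (ivar s6 ''best'')"
        "ivar s' ''x2'' = iarr s4 ''m2'' (ivar s6 ''best'')"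
        by (simp_all add: s'_def arrs)
      obtain j0 where j0: "j0 \<in> {2..n}" "ivar s6 ''best'' = ei j0"
        and fmin: "\<And>j. j \<in> {2..n} \<Longrightarrow> rarr s6 ''f'' (ei j0) \<le> rarr s6 ''f'' (ei j)"
        using 5(1) by (auto simp: s5_def st)
      have "?Q s'"
      proof (rule edge_deletion_result[of ei s s' j0])
        show "bij_betw ei {2..n} {1..card (edges I)}" using ei_bij unfolding m_def .
        show "sides_min n p ord ei (weight I) plen s' j n" if "j \<in> {2..n}" for j
          unfolding sides using mins that sides_min_cong[of s' s4] arrs s' by simp
        show "rarr s' ''f'' (ei j) = lam I * (rarr s' ''c1'' (ei j) + rarr s' ''c2'' (ei j)) +
          (1 - lam I) * \<bar>(\<Sum>i\<in>subtree p n j. z I (ord i)) -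
            ((\<Sum>i\<in>subtree p n 1. z I (ord i)) - (\<Sum>i\<in>subtree p n j. z I (ord i)))\<bar>"
          if j: "j \<in> {2..n}" for j
        proof -
          have "rarr s4 ''zs'' j = (\<Sum>i\<in>subtree p n j. z I (ord i))"
            "rarr s4 ''zs'' 1 = (\<Sum>i\<in>subtree p n 1. z I (ord i))" using zs j by auto
          moreover have "rarr s6 ''f'' (ei j) =
              lam I * (rarr s4 ''c1'' (ei j) + rarr s4 ''c2'' (ei j)) +
              (1 - lam I) * \<bar>rarr s4 ''zs'' j - (rarr s4 ''zs'' 1 - rarr s4 ''zs'' j)\<bar>"
            using 5(1) j by (simp add: s5_def st)
          ultimately show ?thesis using s' arrs by simp
        qed
      qed (use post j0 fmin s' in auto)
      then show ?case
        by (intro runs_run) (simp_all add: s'_def)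
    qed (use st inj ei_pos in \<open>auto simp: s5_def\<close>)
    show ?thesis
      by (rule runs_Seq[OF init, where ?k2.0 = "70 * n + 13"]) (use rest in simp_all)
  qed

  have rest: "runs (Seq preprocess (Seq (accumulate ''zs'') (Seq (loop ''x'' ''n'' scan)
      (Seq (ISet ''best'' (IConst 0)) (Seq evaluate ?fin))))) s1 (163 * n * n + 179 * n + 36) ?Q"
  proof (rule runs_Seq[OF runs_preprocess[OF _ st1(1)[symmetric] order_refl],
        where ?k2.0 = "163 * n * n + 142 * n + 29"], goal_cases)
    case (2 s2)
    note fr2 = frameD[OF 2(2)]
    have st2: "ivar s2 ''n'' = n" "iarr s2 ''pp'' = p" "iarr s2 ''ord'' = ord" "iarr s2 ''ei'' = ei"
      "rvar s2 ''lambda'' = lam I" "rarr s2 ''w'' = w" "rarr s2 ''len'' = rarr s ''len''"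
      using fr2 st1 by (simp_all add: p_def ord_def ei_def w_def)
    have post2: "rarr s2 ''dep'' c = tdist p l 1 c \<and> rarr s2 ''zs'' c = w (ord c) * t (ord c) \<and>
        iarr s2 ''m1'' c = 0 \<and> iarr s2 ''m2'' c = 0" if "c \<in> {1..n}" for c
      using 2(1) that unfolding st1(3) abbr w_def[symmetric] t_def[symmetric] l_def[symmetric] by blast
    show ?case
    proof (rule runs_Seq[OF runs_accumulate[OF _ st2(1)[symmetric] order_refl],
          where ?k2.0 = "163 * n * n + 114 * n + 22"], goal_cases)
      case (2 s3)
      note fr3 = frameD[OF 2(2)]
      have st3: "ivar s3 ''n'' = n" "iarr s3 = iarr s2" "rvar s3 ''lambda'' = lam I"
        "rarr s3 ''w'' = w" "rarr s3 ''len'' = rarr s ''len''" "rarr s3 ''dep'' = rarr s2 ''dep''"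
        using fr3 st2 by (simp_all add: fun_eq_iff)
      have zs: "rarr s3 ''zs'' c = (\<Sum>i\<in>subtree p n c. z I (ord i))" if "c \<in> {1..n}" for c
      proof -
        have "rarr s3 ''zs'' c = (\<Sum>i\<in>subtree p n c. rarr s2 ''zs'' i)"
          using 2(1) that st2(2) by simp
        also have "\<dots> = (\<Sum>i\<in>subtree p n c. w (ord i) * t (ord i))"
          using post2 by (intro sum.cong) (auto simp: subtree_def)
        finally show ?thesis using zsum by simp
      qed
      have "sides_min n p ord ei w l s3 j 0" if "j \<in> {2..n}" for j
      proof -
        \<comment> \<open>Edge indices stay below \<open>n\<close>, hence within the range that
          \<open>preprocess\<close> has cleared.\<close>
        have "ei j \<in> {1..n}" using post(3)[OF that] m by auto
        then show ?thesis using post2[of "ei j"] st3 by (simp add: sides_min_def is_min_def)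
      qed
      then have "runs (loop ''x'' ''n'' scan) s3 (n * (163 * n + 44) + 7) (\<lambda>s'. \<forall>j\<in>{2..n}.
          sides_min n (iarr s3 ''pp'') (iarr s3 ''ord'') (iarr s3 ''ei'') (rarr s3 ''w'')
            (\<lambda>j. rarr s3 ''len'' (iarr s3 ''ei'' j)) s' j n)"
        by (intro runs_scan_all)
          (use st2 st3 ord_pos inj post2 parents_axioms in \<open>simp_all add: l_def[symmetric]\<close>)
      then have scan: "runs (loop ''x'' ''n'' scan) s3 (n * (163 * n + 44) + 7) (\<lambda>s'. \<forall>j\<in>{2..n}.
          sides_min n p ord ei w l s' j n)"
        unfolding st3 st2 l_def[symmetric] .
      show ?case
      proof (rule runs_Seq[OF scan, where ?k2.0 = "70 * n + 15"], goal_cases)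
        case (1 s4)
        note fr4 = frameD[OF 1(2)]
        show ?case
          by (rule fin) (use fr4 st3 st2 zs 1(1) in simp_all)
      qed (simp add: algebra_simps)
    next
      case 3
      show ?case by simp
    qed (use parents_axioms st2 in simp)
  next
    case 3
    show ?case by simp
  qed (use parents_axioms p_def in simp)
  have search: "runs search s (54 * n * n + 28 * n + 29) (\<lambda>s'. s' = s1)"
  proof -
    have "54 * m + 28 \<le> 54 * n + 28" using m by simp
    then have "n * (54 * m + 28) \<le> n * (54 * n + 28)" by (rule mult_le_mono2)
    moreover have "n * (54 * n + 28) = 54 * n * n + 28 * n" by (simp add: algebra_simps)
    ultimately have "k1 \<le> 54 * n * n + 28 * n + 29" using k1 by linarith
    then show ?thesis using exec1 by (auto simp: runs_def)
  qed
  show ?thesis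
    unfolding edge_deletion_def
    by (rule runs_Seq[OF search, where ?k2.0 = "163 * n * n + 179 * n + 36"]) (use rest in simp_all)
qed

theorem mainTheorem3:
  shows "(\<forall>I T1 T2 m1 m2 e.
            valid_instance I \<longrightarrow> edge_deletion_run I T1 T2 m1 m2 e \<longrightarrow>
            optimal I e (T1 e) (T2 e) (m1 e) (m2 e)) \<and>
         (\<exists>(P :: com) (\<tau> :: nat \<Rightarrow> nat).
            (\<lambda>n. real (\<tau> n)) \<in> O(\<lambda>n. real n ^ 2) \<and>
            (\<forall>I s. valid_instance I \<longrightarrow> encodes s I \<longrightarrow>
               (\<exists>k s' T1 T2 m1 m2 e.
                  exec P s k s' \<and> k \<le> \<tau> (num_verts I) \<and>
                  edge_deletion_run I T1 T2 m1 m2 e \<and>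
                  outputs s s' I T1 T2 m1 m2 e \<and>
                  optimal I e (T1 e) (T2 e) (m1 e) (m2 e))))"
proof (intro conjI exI[of _ edge_deletion] exI[of _ "\<lambda>n. 217 * n * n + 207 * n + 65"])
  show "\<forall>I T1 T2 m1 m2 e. valid_instance I \<longrightarrow> edge_deletion_run I T1 T2 m1 m2 e \<longrightarrow>
      optimal I e (T1 e) (T2 e) (m1 e) (m2 e)"
    using edge_deletion_run_optimal by blast
  show "(\<lambda>n. real (217 * n * n + 207 * n + 65)) \<in> O(\<lambda>n. real n ^ 2)"
  \<comment> \<open>489 = 217 + 207 + 65, using that \<open>n\<close> and 1 are at most
    \<open>n * n\<close> for positive \<open>n\<close>.\<close>
  proof (rule bigoI[of _ 489])
    show "\<forall>\<^sub>F n in sequentially. norm (real (217 * n * n + 207 * n + 65)) \<le> 489 * norm (real n ^ 2)"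
      using eventually_ge_at_top[of 1]
    proof eventually_elim
      case (elim n)
      then have "n \<le> n * n" "1 \<le> n * n" by simp_all
      then have "217 * n * n + 207 * n + 65 \<le> 489 * (n * n)" by linarith
      then have "real (217 * n * n + 207 * n + 65) \<le> real (489 * (n * n))" by (rule of_nat_mono)
      then show ?case by (simp add: power2_eq_square)
    qed
  qed
  show "\<forall>I s. valid_instance I \<longrightarrow> encodes s I \<longrightarrow>
      (\<exists>k s' T1 T2 m1 m2 e. exec edge_deletion s k s' \<and>
         k \<le> 217 * num_verts I * num_verts I + 207 * num_verts I + 65 \<and>
         edge_deletion_run I T1 T2 m1 m2 e \<and> outputs s s' I T1 T2 m1 m2 e \<and>
         optimal I e (T1 e) (T2 e) (m1 e) (m2 e))"
    using runs_edge_deletion edge_deletion_run_optimal unfolding runs_def by metis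
qed

end
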